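(* Let $f^*$ be an optimal threshold curve in the memoryless best-choice problem, i.e. a threshold curve with $J(f^* )=v:=\sup_f J(f)$, where the supremum is over all threshold curves, and let $\tau^*$ be the associated memoryless stopping rule. Then $$e^{-f^*(t)}=J(f^*;t)\qquad\text{for all } t\in[0,1),$$ and consequently $\mathbb E\,\tau^*=v$.
   Context: Let $\Pi$ be a Poisson point process of unit rate in $[0,1]\times[0,\infty)$; an atom $(t,x)$ is a score $x$ observed at time $t$. Let $(T,M)$ denote the (a.s. unique) atom of $\Pi$ with the smallest score. A threshold curve is a nondecreasing càdlàg function $f:[0,1)\to[0,\infty)$. The associated memoryless stopping point $(\tau,\xi)$ is the atom of $\Pi$ with the smallest arrival time in the subgraph $\{(t,x): x\le f(t)\}$, with $(\tau,\xi)=(1,\infty)$ if there is no such atom. Set $J(f):=\mathbb P[\tau=T]$. For a threshold curve $f$ let $F(t)=\int_0^t f(s)\,ds$, let $g$ be the generalised inverse of $f$, $g(x)=\sup\{t\in[0,1): f(t)<x\}$ (with $\sup\varnothing=0$, so $g(x)=0$ for $x\le f(0)$), and $G(x)=\int_0^x g(z)\,dz$. Define for $t\in[0,1)$ $$J(f;t):=\int_t^1 e^{-F(u)}\int_0^{f(t)}\exp\bigl(-x(1-u)-G(x)\bigr)\,dx\,du .$$ *)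

theory Defs
  imports "HOL-Probability.Probability"
begin

definition strip :: "(real \<times> real) set" where
  "strip = {0..1} \<times> {0..}"

text \<open>
  A unit-rate Poisson point process on the strip is modelled as a random locally finite set of
  atoms \<open>(t, x)\<close>.  As usual for point processes, local finiteness is required surely, and the law
  is prescribed through the counts of bounded Borel sets.  The mean measure has no atoms, so
  multiple points have probability zero and configurations can be sets rather than multisets.
  The Poisson probabilities are written out because \<^const>\<open>poisson_pmf\<close> is specified only for
  strictly positive rates, while Borel sets of zero area are allowed here.
\<close>

locale unit_poisson_process = prob_space M
  for M :: "'w measure" and \<Phi> :: "'w \<Rightarrow> (real \<times> real) set" +
  assumes atoms_in_strip: "\<And>\<omega>. \<omega> \<in> space M \<Longrightarrow> \<Phi> \<omega> \<subseteq> strip"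
    and locally_finite: "\<And>\<omega> B. \<omega> \<in> space M \<Longrightarrow> bounded B \<Longrightarrow> finite (\<Phi> \<omega> \<inter> B)"
    and count_measurable: "\<And>B. B \<in> sets borel \<Longrightarrow> bounded B \<Longrightarrow> B \<subseteq> strip \<Longrightarrow>
      (\<lambda>\<omega>. card (\<Phi> \<omega> \<inter> B)) \<in> M \<rightarrow>\<^sub>M count_space UNIV"
    and count_poisson: "\<And>B k. B \<in> sets borel \<Longrightarrow> bounded B \<Longrightarrow> B \<subseteq> strip \<Longrightarrow>
      prob {\<omega> \<in> space M. card (\<Phi> \<omega> \<inter> B) = k}
        = measure lborel B ^ k / fact k * exp (- measure lborel B)"
    and count_indep: "\<And>(I :: nat set) B. finite I \<Longrightarrow> disjoint_family_on B I \<Longrightarrow>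
      (\<And>i. i \<in> I \<Longrightarrow> B i \<in> sets borel \<and> bounded (B i) \<and> B i \<subseteq> strip) \<Longrightarrow>
      indep_vars (\<lambda>_. count_space UNIV) (\<lambda>i \<omega>. card (\<Phi> \<omega> \<inter> B i)) I"

text \<open>
  The atom of smallest score is a.s. unique.  On the null event where it is not, the value is
  the fixed constant \<open>undefined\<close>; a choice operator there could destroy measurability.
\<close>

definition best_atom :: "(real \<times> real) set \<Rightarrow> real \<times> real" where
  "best_atom A =
    (if \<exists>!p. is_arg_min snd (\<lambda>p. p \<in> A) p then THE p. is_arg_min snd (\<lambda>p. p \<in> A) p
     else undefined)"

definition best_time :: "(real \<times> real) set \<Rightarrow> real" where
  "best_time A = fst (best_atom A)"

text \<open>Curves live on \<open>[0,1)\<close>; their values elsewhere are irrelevant to the notions below at times in \<open>[0,1)\<close>.\<close>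

definition cadlag :: "(real \<Rightarrow> real) \<Rightarrow> bool" where
  "cadlag f \<longleftrightarrow>
    (\<forall>t\<in>{0..<1}. continuous (at_right t) f) \<and> (\<forall>t\<in>{0<..<1}. \<exists>l. (f \<longlongrightarrow> l) (at_left t))"

definition threshold_curves :: "(real \<Rightarrow> real) set" where
  "threshold_curves = {f. (\<forall>t\<in>{0..<1}. 0 \<le> f t) \<and> mono_on {0..<1} f \<and> cadlag f}"

definition subgraph :: "(real \<Rightarrow> real) \<Rightarrow> (real \<times> real) set" where
  "subgraph f = {(t, x). 0 \<le> t \<and> t < 1 \<and> 0 \<le> x \<and> x \<le> f t}"

text \<open>
  For a locally finite configuration and a threshold curve the smallest arrival time in the
  subgraph is attained, so the first component does not depend on how \<^const>\<open>arg_min\<close> breaks ties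
  between simultaneous atoms (a null event).
\<close>

definition memoryless_point :: "(real \<Rightarrow> real) \<Rightarrow> (real \<times> real) set \<Rightarrow> real \<times> ereal" where
  "memoryless_point f A =
    (if A \<inter> subgraph f = {} then (1, \<infinity>)
     else map_prod id ereal (arg_min fst (\<lambda>p. p \<in> A \<inter> subgraph f)))"

definition memoryless_time :: "(real \<Rightarrow> real) \<Rightarrow> (real \<times> real) set \<Rightarrow> real" where
  "memoryless_time f A = fst (memoryless_point f A)"

definition win_prob :: "'w measure \<Rightarrow> ('w \<Rightarrow> (real \<times> real) set) \<Rightarrow> (real \<Rightarrow> real) \<Rightarrow> real" where
  "win_prob M \<Phi> f = measure M {\<omega> \<in> space M. memoryless_time f (\<Phi> \<omega>) = best_time (\<Phi> \<omega>)}"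

definition optimal_value :: "'w measure \<Rightarrow> ('w \<Rightarrow> (real \<times> real) set) \<Rightarrow> real" where
  "optimal_value M \<Phi> = (SUP f\<in>threshold_curves. win_prob M \<Phi> f)"

definition optimal_curve ::
    "'w measure \<Rightarrow> ('w \<Rightarrow> (real \<times> real) set) \<Rightarrow> (real \<Rightarrow> real) \<Rightarrow> bool" where
  "optimal_curve M \<Phi> f \<longleftrightarrow> f \<in> threshold_curves \<and> win_prob M \<Phi> f = optimal_value M \<Phi>"

definition curve_integral :: "(real \<Rightarrow> real) \<Rightarrow> real \<Rightarrow> real" where
  "curve_integral f t = (LINT s:{0..t}|lborel. f s)"

definition gen_inverse :: "(real \<Rightarrow> real) \<Rightarrow> real \<Rightarrow> real" where
  "gen_inverse f x =
    (if {t\<in>{0..<1}. f t < x} = {} then 0 else Sup {t\<in>{0..<1}. f t < x})"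

definition inverse_integral :: "(real \<Rightarrow> real) \<Rightarrow> real \<Rightarrow> real" where
  "inverse_integral f x = (LINT z:{0..x}|lborel. gen_inverse f z)"

definition partial_win :: "(real \<Rightarrow> real) \<Rightarrow> real \<Rightarrow> real" where
  "partial_win f t =
    (LINT u:{t..<1}|lborel. exp (- curve_integral f u) *
      (LINT x:{0..f t}|lborel. exp (- x * (1 - u) - inverse_integral f x)))"

end

theory Submission
  imports Defs
begin

text \<open>
  By a discretisation of the Poisson process, the success probability of a threshold curve \<open>f\<close> is
  \<open>J(f) = \<integral>\<integral> exp (- x - \<integral>\<^sub>0\<^sup>t (f s - x)\<^sup>+ ds) dx dt\<close> over the subgraph: an atom \<open>(t, x)\<close> of the subgraph
  is selected and best iff there are no atoms below height \<open>x\<close> and none in the subgraph before \<open>t\<close>.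
  The derivative of \<open>J\<close> in the value \<open>f s\<close> is \<open>exp (- f s) - J(f; s)\<close>; both parts are monotone in
  \<open>s\<close> and in the level, so that monotone perturbations of \<open>f\<close> suffice to force it to vanish at every
  \<open>s\<close>.  In particular \<open>f 0 > 0\<close>, so an optimal \<open>f\<close> may be shifted vertically in both directions.
  Substituting \<open>x + e\<close> for \<open>x\<close> gives \<open>J(f + e) = exp (- e) * (J(f) + e * E \<tau> + o(e))\<close>, and optimality
  then yields \<open>J(f) = E \<tau>\<close>.
\<close>

section \<open>The success density\<close>

text \<open>The two terms of the derivative reflect two effects of raising the curve near time
  \<open>s\<close>. The exponent of the density at \<open>(t, x)\<close> is the area that must be
  free of other atoms. The loss is that the forbidden area grows for every candidate
  \<open>(t, x)\<close> with \<open>t > s\<close> and \<open>x < f s\<close>. The density mass of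
  these candidates becomes J(f; s) once the area at \<open>(u, x)\<close> is split into F(u) + x (1
  - u) + G(x).

  Two obstacles shape the argument. A threshold curve may blow up at time 1, so exponents are
  controlled at times below 1 only, and the comparison with the Poisson process is made on a
  truncated time interval before a limit is taken. Moreover a varied curve must remain
  nondecreasing, which rules out local bumps; the variations used are one-sided cuts and lifts with
  an explicit inequality in place of a derivative. The identity for the expected stopping time uses
  a separate family of variations and takes only the positivity of \<open>f 0\<close> from the
  first-order condition.\<close>

text \<open>Values of a curve off \<open>[0,1)\<close> are set to zero, which makes curves Borel measurable.\<close>

definition curve :: "(real \<Rightarrow> real) \<Rightarrow> bool" where
  "curve f \<longleftrightarrow> f \<in> threshold_curves \<and> (\<forall>t. t \<notin> {0..<1} \<longrightarrow> f t = 0)"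

text \<open>The exponent is an area: a slab of height \<open>x\<close> across the unit time
  interval, plus the part of the subgraph before \<open>t\<close> that sticks out above it. For a
  point \<open>(t, x)\<close> of the subgraph these are the places where another atom would be
  better or would be selected earlier.\<close>

definition expo :: "(real \<Rightarrow> real) \<Rightarrow> real \<Rightarrow> real \<Rightarrow> real" where
  "expo f t x = x + (LINT s:{0..<t}|lborel. max (f s - x) 0)"

definition win_density :: "(real \<Rightarrow> real) \<Rightarrow> real \<times> real \<Rightarrow> real" where
  "win_density f p = indicator (subgraph f) p * exp (- expo f (fst p) (snd p))"

definition win_integral :: "(real \<Rightarrow> real) \<Rightarrow> real" where
  "win_integral f = (LINT p|lborel. win_density f p)"

lemma curve_nonneg: "curve f \<Longrightarrow> 0 \<le> f t"
  by (cases "t \<in> {0..<1}") (auto simp: curve_def threshold_curves_def)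

lemma curve_mono: "curve f \<Longrightarrow> s \<le> t \<Longrightarrow> t < 1 \<Longrightarrow> f s \<le> f t"
proof (cases "0 \<le> s")
  case True
  assume "curve f" "s \<le> t" "t < 1"
  with True show ?thesis
    by (auto simp: curve_def threshold_curves_def mono_on_def)
next
  case False
  assume "curve f" "s \<le> t" "t < 1"
  with False show ?thesis
    using curve_nonneg[of f t] by (auto simp: curve_def)
qed

lemma curve_measurable [measurable_dest]:
  assumes "curve f" shows "f \<in> borel_measurable borel"
proof -
  have "mono_on {0..<1} f"
    using assms by (auto simp: curve_def threshold_curves_def)
  then have "f \<in> borel_measurable (restrict_space borel {0..<1})"
    by (rule borel_measurable_mono_on_fnc)
  then have "(\<lambda>t. indicator {0..<1} t *\<^sub>R f t) \<in> borel_measurable borel"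
    by (subst (asm) borel_measurable_restrict_space_iff) auto
  also have "(\<lambda>t. indicator {0..<1} t *\<^sub>R f t) = f"
    using assms by (auto simp: curve_def fun_eq_iff indicator_def)
  finally show ?thesis .
qed

lemma set_integrable_bounded_real:
  fixes g :: "real \<Rightarrow> real"
  assumes "g \<in> borel_measurable borel" "A \<in> sets borel" "bounded A"
    and "\<And>s. s \<in> A \<Longrightarrow> \<bar>g s\<bar> \<le> B"
  shows "set_integrable lborel A g"
  unfolding set_integrable_def
  by (rule integrableI_bounded_set_indicator[where B=B])
    (use assms emeasure_bounded_finite[of A] in auto)

lemma excess_integrable:
  assumes "curve f" "t < 1"
  shows "set_integrable lborel {0..<t} (\<lambda>s. max (f s - x) 0)"
proof (rule set_integrable_bounded_real[where B="f t + \<bar>x\<bar>"])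
  have [measurable]: "f \<in> borel_measurable borel" using assms by measurable
  show "(\<lambda>s. max (f s - x) 0) \<in> borel_measurable borel" by measurable
  show "\<bar>max (f s - x) 0\<bar> \<le> f t + \<bar>x\<bar>" if "s \<in> {0..<t}" for s
    using curve_mono[OF assms(1), of s t] curve_nonneg[OF assms(1), of t] that assms by auto
qed auto

lemma expo_ge: "x \<le> expo f t x"
  unfolding expo_def by (simp add: set_lebesgue_integral_def integral_nonneg)

text \<open>Raising the score by \<open>y - x\<close> lowers the excess by at most that much at each
  time, and the time interval has length at most 1, so the linear term prevails. The excess itself
  can only fall.\<close>

lemma expo_mono_score:
  assumes "curve f" "t < 1" "x \<le> y"
  shows "expo f t x \<le> expo f t y" "expo f t y - expo f t x \<le> y - x"
proof -
  let ?I = "\<lambda>x. LINT s:{0..<t}|lborel. max (f s - x) 0"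
  have "?I y \<le> ?I x"
    by (rule set_integral_mono) (use excess_integrable[OF assms(1,2)] assms(3) in auto)
  then show "expo f t y - expo f t x \<le> y - x" by (simp add: expo_def)
  have "?I x - ?I y = (LINT s:{0..<t}|lborel. max (f s - x) 0 - max (f s - y) 0)"
    by (rule set_integral_diff(2)[symmetric]; rule excess_integrable[OF assms(1,2)])
  also have "\<dots> \<le> (LINT s:{0..<t}|lborel. y - x)"
    by (rule set_integral_mono)
      (use excess_integrable[OF assms(1,2)] assms(3) in \<open>auto intro!: set_integrable_bounded_real\<close>)
  also have "\<dots> \<le> y - x"
    using assms by (cases "0 \<le> t") (auto simp: set_integral_const measure_lborel_Ico mult_left_le_one_le)
  finally show "expo f t x \<le> expo f t y" by (simp add: expo_def)
qed

lemma expo_split: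
  assumes "curve f" "0 \<le> s" "s \<le> t" "t < 1"
  shows "expo f t x = expo f s x + (LINT r:{s..<t}|lborel. max (f r - x) 0)"
proof -
  have "(LINT r:{0..<s} \<union> {s..<t}|lborel. max (f r - x) 0) =
    (LINT r:{0..<s}|lborel. max (f r - x) 0) + (LINT r:{s..<t}|lborel. max (f r - x) 0)"
    by (rule set_integral_Un)
      (use excess_integrable[OF assms(1), of t x] excess_integrable[OF assms(1), of s x] assms
        in \<open>auto intro: set_integrable_subset\<close>)
  moreover have "{0..<s} \<union> {s..<t} = {0..<t}" using assms by auto
  ultimately show ?thesis by (simp add: expo_def)
qed

lemma expo_mono_time:
  assumes "curve f" "0 \<le> s" "s \<le> t" "t < 1" "0 \<le> x"
  shows "expo f s x \<le> expo f t x" "expo f t x - expo f s x \<le> f t * (t - s)"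
proof -
  note eq = expo_split[OF assms(1-4), of x]
  have "0 \<le> (LINT r:{s..<t}|lborel. max (f r - x) 0)" by (simp add: set_lebesgue_integral_def integral_nonneg)
  then show "expo f s x \<le> expo f t x" using eq by simp
  have "(LINT r:{s..<t}|lborel. max (f r - x) 0) \<le> (LINT r:{s..<t}|lborel. f t)"
  proof (rule set_integral_mono)
    show "set_integrable lborel {s..<t} (\<lambda>r. max (f r - x) 0)"
      by (rule set_integrable_subset[OF excess_integrable[OF assms(1,4)]]) (use assms in auto)
    show "max (f r - x) 0 \<le> f t" if "r \<in> {s..<t}" for r
      using curve_mono[OF assms(1), of r t] curve_nonneg[OF assms(1), of t] that assms by auto
  qed (auto intro!: set_integrable_bounded_real)
  also have "\<dots> = f t * (t - s)"
    using assms by (simp add: set_integral_const measure_lborel_Ico)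
  finally show "expo f t x - expo f s x \<le> f t * (t - s)" using eq by simp
qed

text \<open>On and above the curve the past contributes nothing. At \<open>x = f t\<close> this
  makes the density \<open>exp (- f t)\<close>, the first term of the first-order condition.\<close>

lemma expo_diagonal:
  assumes "curve f" "t < 1" "f t \<le> x"
  shows "expo f t x = x"
proof -
  have "max (f s - x) 0 = 0" if "s \<in> {0..<t}" for s
    using curve_mono[of f s t] that assms by auto
  then have "(LINT s:{0..<t}|lborel. max (f s - x) 0) = (LINT s:{0..<t}|lborel. 0)"
    by (intro set_lebesgue_integral_cong) auto
  then show ?thesis by (simp add: expo_def)
qed

lemma subgraph_measurable [measurable]:
  assumes "curve f" shows "subgraph f \<in> sets borel"
proof -
  have [measurable]: "f \<in> borel_measurable borel" using assms by measurable
  have "Measurable.pred (borel \<Otimes>\<^sub>M borel) (\<lambda>p. 0 \<le> fst p \<and> fst p < 1 \<and> 0 \<le> snd p \<and> snd p \<le> f (fst p))"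
    by measurable
  moreover have "{p \<in> space (borel \<Otimes>\<^sub>M borel). 0 \<le> fst p \<and> fst p < 1 \<and> 0 \<le> snd p \<and> snd p \<le> f (fst p)} = subgraph f"
    by (auto simp: subgraph_def space_pair_measure)
  ultimately show ?thesis
    unfolding pred_def by (simp only: borel_prod)
qed

lemma expo_measurable:
  assumes "curve f" shows "(\<lambda>p. expo f (fst p) (snd p)) \<in> borel_measurable borel"
proof -
  have [measurable]: "f \<in> borel_measurable borel" using assms by measurable
  have "(\<lambda>p. expo f (fst p) (snd p)) \<in> borel_measurable (borel \<Otimes>\<^sub>M borel)"
    unfolding expo_def set_lebesgue_integral_def indicator_def atLeastLessThan_iff by measurable
  then show ?thesis by (simp add: borel_prod)
qed

lemma win_density_measurable [measurable]:
  assumes "curve f" shows "win_density f \<in> borel_measurable borel"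
proof -
  have [measurable]: "(\<lambda>p. expo f (fst p) (snd p)) \<in> borel_measurable borel"
    "subgraph f \<in> sets borel"
    using expo_measurable[OF assms] subgraph_measurable[OF assms] by auto
  show ?thesis unfolding win_density_def[abs_def] by measurable
qed

lemma win_density_nonneg: "0 \<le> win_density f p"
  by (simp add: win_density_def)

lemma win_density_le:
  "win_density f p \<le> indicator ({0..<1} \<times> {0..}) p * exp (- snd p)"
  using expo_ge[of "snd p" f "fst p"]
  by (auto simp: win_density_def subgraph_def indicator_def)

text \<open>A majorant independent of the curve, since the subgraph itself may have infinite area
  when the curve blows up at time 1.\<close>

lemma exp_strip_integrable:
  "integrable lborel (\<lambda>p::real \<times> real. indicator ({0..<1} \<times> {0..}) p * exp (- snd p) :: real)"
proof -
  have "integrable lborel (\<lambda>x::real. indicator {0..} x * exp (- x))"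
  proof (rule integrableI_nonneg)
    have "(\<integral>\<^sup>+x. ennreal (indicator {0..} x * exp (- x)) \<partial>lborel)
        = (\<integral>\<^sup>+x. ennreal (x ^ 0 * exp (- x)) * indicator {0..} x \<partial>lborel)"
      by (intro nn_integral_cong) (auto simp: indicator_def)
    also have "\<dots> = 1" by (subst nn_intergal_power_times_exp_Ici) auto
    finally show "(\<integral>\<^sup>+x. ennreal (indicator {0..} x * exp (- x)) \<partial>lborel) < \<infinity>" by simp
  qed auto
  moreover have "integrable lborel (\<lambda>t::real. indicator {0..<1} t :: real)" by simp
  ultimately have "integrable (lborel \<Otimes>\<^sub>M lborel)
      (\<lambda>(t::real, x::real). indicator {0..<1} t * (indicator {0..} x * exp (- x)) :: real)"
    by (intro lborel_pair.Fubini_integrable)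
      (auto simp: abs_mult)
  then show ?thesis
    unfolding lborel_prod
    by (rule back_subst[where P="integrable lborel"]) (auto simp: fun_eq_iff indicator_def)
qed

lemma win_density_integrable:
  assumes "curve f" shows "integrable lborel (win_density f)"
  by (rule Bochner_Integration.integrable_bound[OF exp_strip_integrable])
    (use assms win_density_nonneg win_density_le in \<open>auto\<close>)

section \<open>The first-order condition\<close>

lemma curve_cadlag: "curve f \<Longrightarrow> cadlag f"
  by (simp add: curve_def threshold_curves_def)

lemma curve_right_limit: "curve f \<Longrightarrow> t \<in> {0..<1} \<Longrightarrow> (f \<longlongrightarrow> f t) (at_right t)"
  using curve_cadlag[of f] by (auto simp: cadlag_def continuous_within)

lemma curve_left_limit: "curve f \<Longrightarrow> t \<in> {0<..<1} \<Longrightarrow> \<exists>l. (f \<longlongrightarrow> l) (at_left t)"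
  using curve_cadlag[of f] by (auto simp: cadlag_def)

section \<open>Admissible modifications of a curve\<close>

lemma curveI:
  assumes "\<And>t. 0 \<le> t \<Longrightarrow> t < 1 \<Longrightarrow> 0 \<le> f t"
    and "\<And>s t. 0 \<le> s \<Longrightarrow> s \<le> t \<Longrightarrow> t < 1 \<Longrightarrow> f s \<le> f t"
    and "\<And>t. 0 \<le> t \<Longrightarrow> t < 1 \<Longrightarrow> (f \<longlongrightarrow> f t) (at_right t)"
    and "\<And>t. 0 < t \<Longrightarrow> t < 1 \<Longrightarrow> \<exists>l. (f \<longlongrightarrow> l) (at_left t)"
    and "\<And>t. t \<notin> {0..<1} \<Longrightarrow> f t = 0"
  shows "curve f"
  using assms unfolding curve_def threshold_curves_def cadlag_def mono_on_def
  by (auto simp: continuous_within)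

text \<open>Lifting to a floor, cutting at a ceiling and shifting vertically all act on the values
  of \<open>f\<close> only, so one closure property serves them all.\<close>

lemma curve_compose:
  assumes f: "curve f" and cont: "continuous_on UNIV \<phi>" and "mono \<phi>" and nonneg: "\<And>x. 0 \<le> x \<Longrightarrow> 0 \<le> \<phi> x"
  shows "curve (\<lambda>s. if s \<in> {0..<1} then \<phi> (f s) else 0)" (is "curve ?g")
proof (rule curveI)
  have lim: "((\<lambda>s. \<phi> (f s)) \<longlongrightarrow> \<phi> l) F" if "(f \<longlongrightarrow> l) F" for l F
    using continuous_on_tendsto_compose[OF cont that] by auto
  show "(?g \<longlongrightarrow> ?g t) (at_right t)" if "0 \<le> t" "t < 1" for t
  proof -
    have "eventually (\<lambda>s. \<phi> (f s) = ?g s) (at_right t)"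
      unfolding eventually_at_right_field using that by (intro exI[of _ 1]) auto
    from Lim_transform_eventually[OF lim[OF curve_right_limit[OF f]] this] show ?thesis
      using that by simp
  qed
  show "\<exists>l. (?g \<longlongrightarrow> l) (at_left t)" if "0 < t" "t < 1" for t
  proof -
    obtain l where l: "(f \<longlongrightarrow> l) (at_left t)"
      using curve_left_limit[OF f, of t] \<open>0 < t\<close> \<open>t < 1\<close> by auto
    have "eventually (\<lambda>s. \<phi> (f s) = ?g s) (at_left t)"
      unfolding eventually_at_left_field using that by (intro exI[of _ 0]) auto
    from Lim_transform_eventually[OF lim[OF l] this] show ?thesis by auto
  qed
qed (use assms curve_mono[OF f] curve_nonneg[OF f] in \<open>auto simp: mono_def\<close>)

text \<open>Passing from the lower curve to the upper one keeps monotonicity, and the strict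
  \<open>s < a\<close> gives the jump its right-hand value, as right-continuity demands.\<close>

lemma curve_glue:
  assumes f: "curve f" and g: "curve g" and le: "\<And>s. f s \<le> g s"
  shows "curve (\<lambda>s. if s < a then f s else g s)" (is "curve ?k")
proof (rule curveI)
  show "?k s \<le> ?k t" if "0 \<le> s" "s \<le> t" "t < 1" for s t
    using curve_mono[OF f, of s t] curve_mono[OF g, of s t] le[of s] le[of t] that by auto
  show "(?k \<longlongrightarrow> ?k t) (at_right t)" if "0 \<le> t" "t < 1" for t
  proof (cases "t < a")
    case True
    then have "eventually (\<lambda>s. f s = ?k s) (at_right t)"
      unfolding eventually_at_right_field by (intro exI[of _ a]) auto
    from Lim_transform_eventually[OF curve_right_limit[OF f] this] show ?thesis
      using that True by simp
  next
    case False
    then have "eventually (\<lambda>s. g s = ?k s) (at_right t)"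
      unfolding eventually_at_right_field by (intro exI[of _ "t + 1"]) auto
    from Lim_transform_eventually[OF curve_right_limit[OF g] this] show ?thesis
      using that False by simp
  qed
  show "\<exists>l. (?k \<longlongrightarrow> l) (at_left t)" if "0 < t" "t < 1" for t
  proof (cases "t \<le> a")
    case True
    obtain l where l: "(f \<longlongrightarrow> l) (at_left t)"
      using curve_left_limit[OF f, of t] \<open>0 < t\<close> \<open>t < 1\<close> by auto
    have "eventually (\<lambda>s. f s = ?k s) (at_left t)"
      unfolding eventually_at_left_field using True by (intro exI[of _ "t - 1"]) auto
    from Lim_transform_eventually[OF l this] show ?thesis by auto
  next
    case False
    obtain l where l: "(g \<longlongrightarrow> l) (at_left t)"
      using curve_left_limit[OF g, of t] \<open>0 < t\<close> \<open>t < 1\<close> by auto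
    have "eventually (\<lambda>s. g s = ?k s) (at_left t)"
      unfolding eventually_at_left_field using False by (intro exI[of _ a]) auto
    from Lim_transform_eventually[OF l this] show ?thesis by auto
  qed
qed (use f g curve_nonneg[OF f] curve_nonneg[OF g] in \<open>auto simp: curve_def\<close>)

text \<open>At \<open>c = f s\<close> this is J(f; s). The level is a separate variable so that the
  value of a perturbed curve can be inserted.\<close>

definition win_mass :: "(real \<Rightarrow> real) \<Rightarrow> real \<Rightarrow> real \<Rightarrow> real" where
  "win_mass f s c = (LINT p|lborel. indicator ({s<..} \<times> {..c}) p * win_density f p)"

lemma rectangle_measurable [measurable]:
  fixes A B :: "real set"
  assumes "A \<in> sets borel" "B \<in> sets borel"
  shows "A \<times> B \<in> sets (borel :: (real \<times> real) measure)"
  using pair_measureI[OF assms] by (simp only: borel_prod)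

lemma emeasure_rectangle:
  fixes a b c d :: real
  assumes "a \<le> b" "c \<le> d"
  shows "emeasure lborel ({a..b} \<times> {c..d}) = ennreal ((b - a) * (d - c))"
proof -
  have "emeasure (lborel \<Otimes>\<^sub>M lborel) ({a..b} \<times> {c..d}) = emeasure lborel {a..b} * emeasure lborel {c..d}"
    by (rule lborel.emeasure_pair_measure_Times) auto
  then show ?thesis using assms by (simp add: lborel_prod ennreal_mult)
qed

lemma win_mass_integrable:
  assumes "curve f"
  shows "integrable lborel (\<lambda>p. indicator ({s<..} \<times> {..c}) p * win_density f p)"
  by (rule integrable_real_mult_indicator[OF _ win_density_integrable[OF assms],
      unfolded mult.commute[of "win_density f _"]]) auto

lemma win_mass_mono:
  assumes "curve f" "s \<le> s'" "c \<le> c'"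
  shows "win_mass f s' c \<le> win_mass f s c'"
  unfolding win_mass_def
  by (rule integral_mono[OF win_mass_integrable[OF assms(1)] win_mass_integrable[OF assms(1)]])
    (use assms win_density_nonneg in \<open>auto simp: indicator_def\<close>)

lemma win_density_le_1: "win_density f p \<le> 1"
  using expo_ge[of "snd p" f "fst p"]
  by (auto simp: win_density_def subgraph_def indicator_def)

text \<open>The density is at most 1, so the mass that is not kept costs at most the area of a
  rectangle covering it. The choice of the rectangle yields Lipschitz bounds in the level and in
  time.\<close>

lemma win_mass_diff_le:
  assumes f: "curve f" and le: "a \<le> b" "c \<le> d"
    and sub: "({s<..} \<times> {..y}) \<inter> subgraph f \<subseteq> ({s'<..} \<times> {..y'}) \<union> ({a..b} \<times> {c..d})"
  shows "win_mass f s y - win_mass f s' y' \<le> (b - a) * (d - c)"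
proof -
  let ?Q = "{a..b} \<times> {c..d}"
  have em: "emeasure lborel ?Q = ennreal ((b - a) * (d - c))"
    by (rule emeasure_rectangle[OF le])
  have int: "integrable lborel (indicator ?Q :: real \<times> real \<Rightarrow> real)"
    by (rule integrable_real_indicator) (auto simp: em)
  have "win_mass f s y \<le> (LINT p|lborel. indicator ({s'<..} \<times> {..y'}) p * win_density f p + indicator ?Q p)"
    unfolding win_mass_def
  proof (rule integral_mono[OF win_mass_integrable[OF f]])
    show "integrable lborel (\<lambda>p. indicator ({s'<..} \<times> {..y'}) p * win_density f p + indicator ?Q p)"
      by (intro Bochner_Integration.integrable_add win_mass_integrable[OF f] int)
    fix p
    have "p \<notin> subgraph f \<Longrightarrow> win_density f p = 0" by (simp add: win_density_def)
    then show "indicator ({s<..} \<times> {..y}) p * win_density f p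
        \<le> indicator ({s'<..} \<times> {..y'}) p * win_density f p + indicator ?Q p"
      using sub win_density_nonneg[of f p] win_density_le_1[of f p]
      by (cases "p \<in> subgraph f") (auto simp: indicator_def)
  qed
  also have "\<dots> = win_mass f s' y' + measure lborel ?Q"
    unfolding win_mass_def
    by (subst Bochner_Integration.integral_add) (auto intro: win_mass_integrable[OF f] int)
  also have "measure lborel ?Q = (b - a) * (d - c)"
    using le by (simp add: measure_def em)
  finally show ?thesis by simp
qed

lemma win_mass_Lipschitz_score:
  assumes "curve f" "c \<le> d"
  shows "win_mass f s d - win_mass f s c \<le> d - c"
proof -
  have "win_mass f s d - win_mass f s c \<le> (1 - 0) * (d - c)"
    by (rule win_mass_diff_le[OF assms(1)]) (use assms(2) in \<open>auto simp: subgraph_def\<close>)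
  then show ?thesis by simp
qed

lemma win_mass_Lipschitz_time:
  assumes "curve f" "s \<le> s'" "0 \<le> c"
  shows "win_mass f s c - win_mass f s' c \<le> (s' - s) * c"
proof -
  have "win_mass f s c - win_mass f s' c \<le> (s' - s) * (c - 0)"
    by (rule win_mass_diff_le[OF assms(1)]) (use assms(2,3) in \<open>auto simp: subgraph_def\<close>)
  then show ?thesis by simp
qed

lemma win_mass_zero:
  assumes "curve f"
  shows "win_mass f s 0 = 0"
proof -
  \<comment> \<open>The level \<open>-1\<close> lies below the whole subgraph, and a rectangle of
    height zero covers what remains at level 0.\<close>
  have "win_mass f s 0 - win_mass f s (-1) \<le> (1 - 0) * (0 - 0)"
    by (rule win_mass_diff_le[OF assms]) (auto simp: subgraph_def)
  moreover have "win_mass f s (-1) = 0"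
    unfolding win_mass_def
    by (rule integral_eq_zero_AE) (auto simp: win_density_def subgraph_def indicator_def)
  moreover have "0 \<le> win_mass f s 0"
    unfolding win_mass_def by (intro Bochner_Integration.integral_nonneg mult_nonneg_nonneg win_density_nonneg) auto
  ultimately show ?thesis by simp
qed

lemma integrable_pair_mult:
  fixes a :: "'a::euclidean_space \<Rightarrow> real" and b :: "'b::euclidean_space \<Rightarrow> real"
  assumes "integrable lborel a" "integrable lborel b"
  shows "integrable (lborel \<Otimes>\<^sub>M lborel) (\<lambda>(x, y). a x * b y)"
proof -
  show ?thesis
    using assms by (intro lborel_pair.Fubini_integrable) (auto simp: abs_mult)
qed

lemma subgraph_section:
  assumes "curve f"
  shows "indicator (subgraph f) (t, x) = (indicator {0..<1} t * indicator {0..f t} x :: real)"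
  by (auto simp: subgraph_def indicator_def)

lemma subgraph_section_integral:
  assumes "curve f"
  shows "integrable lborel (\<lambda>x. indicator (subgraph f) (t, x) :: real)"
    and "(LINT x|lborel. indicator (subgraph f) (t, x)) = f t"
proof -
  show "integrable lborel (\<lambda>x. indicator (subgraph f) (t, x) :: real)"
    unfolding subgraph_section[OF assms]
    by (intro integrable_mult_right integrable_real_indicator) (use curve_nonneg[OF assms, of t] in auto)
  show "(LINT x|lborel. indicator (subgraph f) (t, x)) = f t"
    unfolding subgraph_section[OF assms]
    using curve_nonneg[OF assms, of t] assms
    by (auto simp: curve_def indicator_def[of "{0..<1}"])
qed

text \<open>The derivative of the success probability as the curve is raised at time \<open>s\<close>, from level \<open>c\<close>.\<close>

definition gain :: "(real \<Rightarrow> real) \<Rightarrow> real \<Rightarrow> real \<Rightarrow> real" where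
  "gain f s c = exp (- c) - win_mass f s c"

text \<open>The convexity bound \<open>exp (- a') \<ge> exp (- a) * (1 - (a' - a))\<close> makes this first-order expansion a
  one-sided inequality without error term, provided \<^const>\<open>gain\<close> is evaluated at the new level.\<close>

lemma win_integral_increment:
  assumes f: "curve f" and f': "curve f'" and bound: "\<And>s. \<bar>f' s - f s\<bar> \<le> C"
  shows "integrable lborel (\<lambda>s. (f' s - f s) * gain f s (f' s))" (is ?int)
    and "(LINT s|lborel. (f' s - f s) * gain f s (f' s)) \<le> win_integral f' - win_integral f" (is ?le)
proof -
  define h where "h s = f' s - f s" for s
  have [measurable]: "f \<in> borel_measurable borel" "f' \<in> borel_measurable borel"
    "win_density f \<in> borel_measurable borel"
    "subgraph f \<in> sets borel" "subgraph f' \<in> sets borel"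
    using f f' by measurable
  have hm [measurable]: "h \<in> borel_measurable borel" unfolding h_def by measurable
  have h_out: "h s = 0" if "s \<notin> {0..<1}" for s
    using that f f' by (simp add: h_def curve_def)
  have h_bound: "\<bar>h s\<bar> \<le> C * indicator {0..<1} s" for s
    using bound[of s] h_out[of s] by (auto simp: h_def indicator_def)
  have int_1: "integrable lborel (\<lambda>s. C * indicator {0..<1::real} s)"
    by (intro integrable_mult_right integrable_real_indicator) auto
  \<comment> \<open>\<open>k s\<close> is the part of the density whose exponent is charged for a
    change of the curve at time \<open>s\<close>.\<close>
  define k where "k s p = indicator ({s<..} \<times> {..f' s}) p * win_density f p" for s p
  have k_int: "integrable lborel (k s)" for s
    unfolding k_def[abs_def] by (rule win_mass_integrable[OF f])
  have k_bound: "\<bar>k s p\<bar> \<le> win_density f p" for s p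
    using win_density_nonneg[of f p] by (auto simp: k_def indicator_def)
  have km: "(\<lambda>(s, p). k s p) \<in> borel_measurable (lborel \<Otimes>\<^sub>M lborel)"
  proof -
    have [measurable]: "win_density f \<in> borel_measurable (borel \<Otimes>\<^sub>M borel)"
      by (simp add: borel_prod)
    have "(\<lambda>q. (if fst q < fst (snd q) \<and> snd (snd q) \<le> f' (fst q) then 1 else 0) * win_density f (snd q))
      \<in> borel_measurable (borel \<Otimes>\<^sub>M (borel \<Otimes>\<^sub>M borel))"
      by measurable
    also have "(\<lambda>q. (if fst q < fst (snd q) \<and> snd (snd q) \<le> f' (fst q) then 1 else 0) * win_density f (snd q))
      = (\<lambda>(s, p). k s p)"
      by (auto simp: k_def fun_eq_iff indicator_def)
    finally show ?thesis by (simp add: lborel_prod borel_prod)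
  qed
  have hk: "integrable (lborel \<Otimes>\<^sub>M lborel) (\<lambda>(s, p). h s * k s p)"
  proof (rule Bochner_Integration.integrable_bound[OF integrable_pair_mult[OF int_1 win_density_integrable[OF f]]])
    show "(\<lambda>(s, p). h s * k s p) \<in> borel_measurable (lborel \<Otimes>\<^sub>M lborel)"
      using km by measurable
    show "AE q in lborel \<Otimes>\<^sub>M lborel. norm (case q of (s, p) \<Rightarrow> h s * k s p)
        \<le> norm (case q of (s, p) \<Rightarrow> C * indicator {0..<1} s * win_density f p)"
    proof (intro AE_I2)
      fix q :: "real \<times> real \<times> real"
      obtain s p where q: "q = (s, p)" by (cases q)
      have "\<bar>h s\<bar> * \<bar>k s p\<bar> \<le> C * indicator {0..<1} s * win_density f p"
        by (intro mult_mono h_bound k_bound) (use h_bound[of s] in auto)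
      then show "norm (case q of (s, p) \<Rightarrow> h s * k s p)
        \<le> norm (case q of (s, p) \<Rightarrow> C * indicator {0..<1} s * win_density f p)"
        unfolding q by (simp only: case_prod_conv real_norm_def abs_mult[of "h s"])
    qed
  qed
  have mass: "integral\<^sup>L lborel (k s) = win_mass f s (f' s)" for s
    by (simp add: win_mass_def k_def[abs_def])
  have mass_int: "integrable lborel (\<lambda>s. h s * win_mass f s (f' s))"
    using lborel_pair.integrable_fst[OF hk] by (simp add: mass)
  \<comment> \<open>Integrating over \<open>s\<close> first gives the loss at a fixed candidate
    \<open>p\<close>; the other order gives the masses that occur in \<open>gain\<close>.\<close>
  define r where "r p = (LINT s|lborel. h s * k s p)" for p
  have r_int: "integrable lborel r"
    unfolding r_def using lborel_pair.integrable_snd[OF hk] by simp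
  have swap: "(LINT p|lborel. r p) = (LINT s|lborel. h s * win_mass f s (f' s))"
    unfolding r_def using lborel_pair.Fubini_integral[OF hk] by (simp add: mass)

  \<comment> \<open>The region between the two curves, counted with sign and weighted on each
    vertical line by the constant \<open>exp (- f' t)\<close>. Its sections integrate to the first
    term of the expansion.\<close>
  define d where "d p = (indicator (subgraph f') p - indicator (subgraph f) p) * exp (- f' (fst p))" for p :: "real \<times> real"
  have d_sec: "integrable lborel (\<lambda>x. d (t, x))" "(LINT x|lborel. d (t, x)) = h t * exp (- f' t)" for t
  proof -
    note i = subgraph_section_integral[OF f, of t] subgraph_section_integral[OF f', of t]
    show "integrable lborel (\<lambda>x. d (t, x))"
      unfolding d_def fst_conv by (intro integrable_mult_left Bochner_Integration.integrable_diff i)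
    show "(LINT x|lborel. d (t, x)) = h t * exp (- f' t)"
      using i unfolding d_def fst_conv by (simp add: h_def)
  qed
  have d_abs: "(LINT x|lborel. \<bar>d (t, x)\<bar>) = \<bar>h t\<bar> * exp (- f' t)" for t
  proof (cases "f t \<le> f' t")
    case True
    then have "\<bar>d (t, x)\<bar> = d (t, x)" for x
      by (auto simp: d_def subgraph_def indicator_def)
    then show ?thesis using d_sec(2)[of t] True by (simp add: h_def)
  next
    case False
    then have "\<bar>d (t, x)\<bar> = - d (t, x)" for x
      by (auto simp: d_def subgraph_def indicator_def)
    then show ?thesis using d_sec(2)[of t] False by (simp add: h_def algebra_simps)
  qed
  have he_int: "integrable lborel (\<lambda>t. h t * exp (- f' t))"
  proof (rule Bochner_Integration.integrable_bound[OF int_1])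
    show "AE t in lborel. norm (h t * exp (- f' t)) \<le> norm (C * indicator {0..<1} t)"
    proof (intro AE_I2)
      fix t
      have "\<bar>h t\<bar> * exp (- f' t) \<le> (C * indicator {0..<1} t) * 1"
        by (intro mult_mono h_bound) (use h_bound[of t] curve_nonneg[OF f', of t] in auto)
      then show "norm (h t * exp (- f' t)) \<le> norm (C * indicator {0..<1} t)"
        unfolding real_norm_def abs_mult[of "h t"] abs_exp_cancel by linarith
    qed
  qed measurable
  have d_meas: "d \<in> borel_measurable borel"
  proof -
    have "(\<lambda>p::real \<times> real. fst p) \<in> borel_measurable borel"
      by (intro borel_measurable_continuous_onI continuous_intros)
    from measurable_compose[OF this curve_measurable[OF f']]
    show ?thesis unfolding d_def[abs_def]
      using f f' by (intro borel_measurable_times borel_measurable_diff borel_measurable_indicator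
          borel_measurable_exp borel_measurable_uminus subgraph_measurable) auto
  qed
  have d_int': "integrable (lborel \<Otimes>\<^sub>M lborel) d"
  proof (rule lborel_pair.Fubini_integrable)
    show "d \<in> borel_measurable (lborel \<Otimes>\<^sub>M lborel)" using d_meas by (simp add: lborel_prod)
    show "integrable lborel (\<lambda>t. LINT x|lborel. norm (d (t, x)))"
      using integrable_abs[OF he_int] by (simp add: d_abs abs_mult)
    show "AE t in lborel. integrable lborel (\<lambda>x. d (t, x))" using d_sec by simp
  qed
  then have d_int: "integrable lborel d" by (simp add: lborel_prod)
  have d_val: "(LINT p|lborel. d p) = (LINT t|lborel. h t * exp (- f' t))"
    using lborel_pair.integral_fst'[OF d_int'] by (simp add: d_sec(2) lborel_prod)

  have pointwise: "d p - r p \<le> win_density f' p - win_density f p" for p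
  proof -
    obtain t x where p: "p = (t, x)" by (cases p)
    show ?thesis
    proof (cases "0 \<le> t \<and> t < 1 \<and> 0 \<le> x")
      case False
      then have "win_density f p = 0" "win_density f' p = 0" "d p = 0"
        by (auto simp: p d_def win_density_def subgraph_def)
      moreover from this have "r p = 0" by (simp add: r_def k_def)
      ultimately show ?thesis by simp
    next
      case True
      let ?e = "expo f t x" and ?e' = "expo f' t x"
      define I where "I = (indicator (subgraph f) p :: real)"
      define I' where "I' = (indicator (subgraph f') p :: real)"
      have I: "I = (if x \<le> f t then 1 else 0)" "I' = (if x \<le> f' t then 1 else 0)"
        using True by (auto simp: I_def I'_def p subgraph_def)
      \<comment> \<open>Replacing the true weight by \<open>exp (- f' t)\<close> errs in the right
        direction: on added points the new exponent is at most \<open>f' t\<close>, on removed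
        points at least.\<close>
      have "expo f' t (f' t) = f' t" by (rule expo_diagonal[OF f']) (use True in auto)
      then have "(I' - I) * exp (- f' t) \<le> (I' - I) * exp (- ?e')"
        using expo_mono_score(1)[OF f', of t x "f' t"] expo_mono_score(1)[OF f', of t "f' t" x] True
        by (auto simp: I)
      moreover have "- r p \<le> I * (exp (- ?e') - exp (- ?e))"
      proof -
        let ?k = "LINT s:{0..<t}|lborel. h s * indicator {..f' s} x"
        have kk: "set_integrable lborel {0..<t} (\<lambda>s. h s * indicator {..f' s} x)"
        proof (rule set_integrable_bounded_real[where B=C])
          have "(\<lambda>s. h s * (if x \<le> f' s then 1 else 0)) \<in> borel_measurable borel"
            by measurable
          also have "(\<lambda>s. h s * (if x \<le> f' s then 1 else 0)) = (\<lambda>s. h s * indicator {..f' s} x)"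
            by (auto simp: indicator_def)
          finally show "(\<lambda>s. h s * indicator {..f' s} x) \<in> borel_measurable borel" .
          show "\<bar>h s * indicator {..f' s} x\<bar> \<le> C" for s
            using bound[of s] by (auto simp: h_def indicator_def)
        qed auto
        have "?e' - ?e = (LINT s:{0..<t}|lborel. max (f' s - x) 0 - max (f s - x) 0)"
          unfolding expo_def
          by (subst set_integral_diff) (use excess_integrable[OF f] excess_integrable[OF f'] True in auto)
        \<comment> \<open>Convexity of the positive part, with the slope taken at the new value
          \<open>f' s\<close>; this matches the level at which \<open>gain\<close> is
          evaluated.\<close>
        also have "\<dots> \<le> ?k"
          by (rule set_integral_mono[OF _ kk])
            (use excess_integrable[OF f] excess_integrable[OF f'] True in
              \<open>auto simp: h_def indicator_def intro!: set_integral_diff\<close>)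
        finally have le: "?e' - ?e \<le> ?k" .
        have "exp (- ?e) * (1 - ?k) \<le> exp (- ?e) * (1 - (?e' - ?e))"
          using le by simp
        also have "\<dots> \<le> exp (- ?e) * exp (- (?e' - ?e))"
          using exp_ge_add_one_self[of "- (?e' - ?e)"] by (intro mult_left_mono) (linarith, simp)
        also have "\<dots> = exp (- ?e')" by (simp add: exp_add[symmetric])
        finally have "- exp (- ?e) * ?k \<le> exp (- ?e') - exp (- ?e)"
          by (simp add: algebra_simps)
        moreover have "r p = win_density f p * ?k"
        proof -
          have "h s * k s p = win_density f p * (indicator {0..<t} s *\<^sub>R (h s * indicator {..f' s} x))" for s
            using h_out[of s] by (auto simp: k_def p indicator_def)
          then show ?thesis unfolding r_def set_lebesgue_integral_def by (simp only: integral_mult_right_zero)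
        qed
        moreover have "win_density f p = I * exp (- ?e)"
          by (simp add: win_density_def I_def p)
        ultimately show ?thesis by (auto simp: I)
      qed
      moreover have "win_density f p = I * exp (- ?e)" "win_density f' p = I' * exp (- ?e')"
        "d p = (I' - I) * exp (- f' t)"
        by (simp_all add: win_density_def I_def I'_def p d_def)
      ultimately show ?thesis by (simp add: algebra_simps)
    qed
  qed

  have eq: "(f' s - f s) * gain f s (f' s) = h s * exp (- f' s) - h s * win_mass f s (f' s)" for s
    by (simp add: gain_def h_def algebra_simps)
  show ?int unfolding eq by (intro Bochner_Integration.integrable_diff he_int mass_int)
  have "(LINT s|lborel. (f' s - f s) * gain f s (f' s)) = (LINT p|lborel. d p - r p)"
    unfolding eq using he_int mass_int d_int r_int d_val swap by simp
  also have "\<dots> \<le> (LINT p|lborel. win_density f' p - win_density f p)"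
    by (intro integral_mono pointwise Bochner_Integration.integrable_diff d_int r_int
        win_density_integrable f f')
  also have "\<dots> = win_integral f' - win_integral f"
    unfolding win_integral_def
    by (intro Bochner_Integration.integral_diff win_density_integrable f f')
  finally show ?le .
qed

text \<open>A later time or a lower level leaves less mass to lose, and a lower level also increases
  \<open>exp (- c)\<close>.\<close>

lemma gain_mono:
  assumes "curve f" "s \<le> s'" "c \<le> c'"
  shows "gain f s c' \<le> gain f s' c"
  using win_mass_mono[OF assms] assms(3) unfolding gain_def
  by (smt (verit) exp_le_cancel_iff)

text \<open>The exponential on nonnegative levels and the mass contribute slope 1 each.\<close>

lemma gain_Lipschitz_score:
  assumes "curve f" "0 \<le> c" "c \<le> d"
  shows "gain f s c - gain f s d \<le> 2 * (d - c)"
proof -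
  have "exp (- c) * (1 - (d - c)) \<le> exp (- c) * exp (- (d - c))"
    using exp_ge_add_one_self[of "- (d - c)"] by (intro mult_left_mono) (linarith, simp)
  also have "\<dots> = exp (- d)" by (simp add: exp_add[symmetric])
  finally have "exp (- c) - exp (- d) \<le> exp (- c) * (d - c)" by (simp add: algebra_simps)
  also have "\<dots> \<le> 1 * (d - c)" by (intro mult_right_mono) (use assms in auto)
  finally show ?thesis
    using win_mass_Lipschitz_score[OF assms(1,3), of s] by (simp add: gain_def)
qed

lemma gain_Lipschitz_time:
  assumes "curve f" "s \<le> s'" "0 \<le> c"
  shows "gain f s' c - gain f s c \<le> (s' - s) * c"
  using win_mass_Lipschitz_time[OF assms] by (simp add: gain_def)

lemma integral_pos_of_ge:
  fixes \<phi> :: "real \<Rightarrow> real"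
  assumes "integrable lborel \<phi>" "\<And>s. 0 \<le> \<phi> s" "a < b" "0 < m" "\<And>s. s \<in> {a..<b} \<Longrightarrow> m \<le> \<phi> s"
  shows "0 < (LINT s|lborel. \<phi> s)"
proof -
  have "0 < m * (b - a)" using assms by simp
  also have "\<dots> = (LINT s|lborel. m * indicator {a..<b} s)"
    using assms by simp
  also have "\<dots> \<le> (LINT s|lborel. \<phi> s)"
  proof (rule integral_mono)
    show "integrable lborel (\<lambda>s. m * indicator {a..<b} s)"
      by (intro integrable_mult_right integrable_real_indicator) (use assms in auto)
  qed (use assms in \<open>auto simp: indicator_def\<close>)
  finally show ?thesis .
qed

text \<open>If the gain at \<open>(s0, f s0)\<close> is positive, lift \<open>f\<close> to slightly above \<open>f s0\<close> from \<open>s0\<close> on; if it is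
  negative, cut \<open>f\<close> slightly below \<open>f s0\<close> up to some \<open>s1 > s0\<close>.  By monotonicity of the gain, its sign
  persists wherever the curve has been changed, so no case distinction on jumps or flat pieces of
  \<open>f\<close> is needed.\<close>

lemma gain_optimal:
  assumes f: "curve f" and opt: "\<And>f'. curve f' \<Longrightarrow> win_integral f' \<le> win_integral f"
    and s0: "s0 \<in> {0..<1}"
  shows "gain f s0 (f s0) = 0"
proof (rule antisym)
  have c0: "0 \<le> f s0" by (rule curve_nonneg[OF f])
  show "gain f s0 (f s0) \<le> 0"
  proof (rule ccontr)
    assume "\<not> ?thesis"
    then have pos: "0 < gain f s0 (f s0)" by simp
    \<comment> \<open>The gain has slope at most 2 in the level, so a rise by a quarter of the gain
      costs at most half of it.\<close>
    define e where "e = gain f s0 (f s0) / 4"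
    have e: "0 < e" using pos by (simp add: e_def)
    define c where "c = f s0 + e"
    have gc: "gain f s0 (f s0) / 2 \<le> gain f s0 c"
      using gain_Lipschitz_score[OF f c0, of c s0] e by (simp add: c_def e_def)
    define g where "g s = (if s \<in> {0..<1} then max (f s) c else 0)" for s
    have g: "curve g"
      unfolding g_def by (rule curve_compose[OF f, of "\<lambda>x. max x c"])
        (auto intro!: continuous_intros simp: mono_def)
    define f' where "f' s = (if s < s0 then f s else g s)" for s
    have f': "curve f'"
      unfolding f'_def using f by (intro curve_glue f g) (auto simp: g_def curve_def)
    have bound: "\<bar>f' s - f s\<bar> \<le> c" for s
      using f curve_nonneg[OF f, of s] c0 e by (auto simp: f'_def g_def c_def curve_def)
    \<comment> \<open>Right-continuity keeps \<open>f\<close> at least \<open>e / 2\<close> below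
      the new level \<open>c\<close> for a while, so the lift acts on a set of positive
      length.\<close>
    have ev: "eventually (\<lambda>s. f s < f s0 + e / 2) (at_right s0)"
      using curve_right_limit[OF f s0] e by (intro order_tendstoD) auto
    then obtain b where b: "s0 < b" "\<And>s. s0 < s \<Longrightarrow> s < b \<Longrightarrow> f s < f s0 + e / 2"
      unfolding eventually_at_right_field by auto
    have gain_ge: "gain f s0 (f s0) / 2 \<le> gain f s (f' s)" if "f' s \<noteq> f s" for s
    proof -
      have "s0 \<le> s" "f' s = c" using that f by (auto simp: f'_def g_def curve_def split: if_splits)
      with gain_mono[OF f, of s0 s c c] gc show ?thesis by simp
    qed
    have f'_ge: "f s \<le> f' s" for s using f by (auto simp: f'_def g_def curve_def)
    have "0 < (LINT s|lborel. (f' s - f s) * gain f s (f' s))"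
    proof (rule integral_pos_of_ge)
      show "integrable lborel (\<lambda>s. (f' s - f s) * gain f s (f' s))"
        by (rule win_integral_increment(1)[OF f f' bound])
      show "0 \<le> (f' s - f s) * gain f s (f' s)" for s
        using gain_ge[of s] f'_ge[of s] pos by (cases "f' s = f s") auto
      show "s0 < min b 1" using b s0 by auto
      show "0 < e / 2 * (gain f s0 (f s0) / 2)" using e pos by simp
      show "e / 2 * (gain f s0 (f s0) / 2) \<le> (f' s - f s) * gain f s (f' s)"
        if "s \<in> {s0..<min b 1}" for s
      proof -
        have "f s \<le> f s0 + e / 2" using b(2)[of s] that e by (cases "s = s0") auto
        moreover have "c \<le> f' s" using that s0 by (auto simp: f'_def g_def)
        ultimately have "e / 2 \<le> f' s - f s" by (simp add: c_def)
        with gain_ge[of s] e pos show ?thesis by (intro mult_mono) auto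
      qed
    qed
    with win_integral_increment(2)[OF f f' bound] opt[OF f'] show False by simp
  qed
  show "0 \<le> gain f s0 (f s0)"
  proof (rule ccontr)
    assume "\<not> ?thesis"
    then have neg: "gain f s0 (f s0) < 0" by simp
    \<comment> \<open>At level 0 no mass is at stake and the gain equals 1; a negative gain
      therefore leaves room for a cut.\<close>
    then have c0': "0 < f s0"
      using c0 win_mass_zero[OF f, of s0] by (cases "f s0 = 0") (auto simp: gain_def)
    \<comment> \<open>The gain starts at \<open>- 4 * m\<close>. Lowering the level by
      \<open>e\<close> raises it by at most \<open>2 * e <= m\<close>, and moving the time to
      \<open>s1\<close> by at most another \<open>m\<close>, so it stays below
      \<open>- m\<close>.\<close>
    define m where "m = - gain f s0 (f s0) / 4"
    have m: "0 < m" using neg by (simp add: m_def)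
    define e where "e = min (f s0) (m / 2)"
    have e: "0 < e" "e \<le> f s0" "2 * e \<le> m" using m c0' by (auto simp: e_def)
    define c where "c = f s0 - e"
    have c: "0 \<le> c" using e by (simp add: c_def)
    \<comment> \<open>The first bound keeps \<open>s1\<close> below 1, so that \<open>f s1\<close>
      bounds the size of the cut. The denominator \<open>c + 1\<close> covers the case
      \<open>c = 0\<close>.\<close>
    define s1 where "s1 = min ((s0 + 1) / 2) (s0 + m / (c + 1))"
    have s1: "s0 < s1" "s1 < 1" using s0 m c by (auto simp: s1_def min_less_iff_disj)
    have "(s1 - s0) * c \<le> m / (c + 1) * (c + 1)"
      by (intro mult_mono) (use c m s1 in \<open>auto simp: s1_def\<close>)
    then have "(s1 - s0) * c \<le> m" using c by simp
    then have gc: "gain f s1 c \<le> - m"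
      using gain_Lipschitz_time[OF f, of s0 s1 c] gain_Lipschitz_score[OF f c, of "f s0" s0] c s1 e
      by (simp add: c_def m_def)
    define g where "g s = (if s \<in> {0..<1} then min (f s) c else 0)" for s
    have g: "curve g"
      unfolding g_def by (rule curve_compose[OF f, of "\<lambda>x. min x c"])
        (use c in \<open>auto intro!: continuous_intros simp: mono_def\<close>)
    define f' where "f' s = (if s < s1 then g s else f s)" for s
    have f': "curve f'"
      unfolding f'_def using f by (intro curve_glue f g) (auto simp: g_def curve_def)
    have bound: "\<bar>f' s - f s\<bar> \<le> f s1" for s
      using f c curve_mono[OF f, of s s1] curve_nonneg[OF f, of s] curve_nonneg[OF f, of s1] s1
      by (auto simp: f'_def g_def curve_def min_def)
    have gain_le: "gain f s (f' s) \<le> - m" if "f' s \<noteq> f s" for s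
    proof -
      have "s \<le> s1" "f' s = c" using that f by (auto simp: f'_def g_def curve_def split: if_splits)
      with gain_mono[OF f, of s s1 c c] gc show ?thesis by simp
    qed
    have f'_le: "f' s \<le> f s" for s using f by (auto simp: f'_def g_def curve_def)
    have "0 < (LINT s|lborel. (f' s - f s) * gain f s (f' s))"
    proof (rule integral_pos_of_ge)
      show "integrable lborel (\<lambda>s. (f' s - f s) * gain f s (f' s))"
        by (rule win_integral_increment(1)[OF f f' bound])
      show "0 \<le> (f' s - f s) * gain f s (f' s)" for s
        using gain_le[of s] f'_le[of s] m by (cases "f' s = f s") (auto intro!: mult_nonpos_nonpos)
      show "s0 < s1" by (rule s1)
      show "0 < e * m" using e m by simp
      show "e * m \<le> (f' s - f s) * gain f s (f' s)" if "s \<in> {s0..<s1}" for s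
      proof -
        \<comment> \<open>By monotonicity the curve stays above \<open>f s0\<close> on the whole
          interval, so the cut removes at least \<open>e\<close> there.\<close>
        have "f s0 \<le> f s" using curve_mono[OF f, of s0 s] that s1 by auto
        moreover have "f' s \<le> c" using that s0 s1 by (auto simp: f'_def g_def)
        ultimately have "e \<le> f s - f' s" by (simp add: c_def)
        with gain_le[of s] e m have "e * m \<le> (f s - f' s) * (- gain f s (f' s))"
          by (intro mult_mono) auto
        then show ?thesis by (simp add: algebra_simps)
      qed
    qed
    with win_integral_increment(2)[OF f f' bound] opt[OF f'] show False by simp
  qed
qed

section \<open>Vertical shifts\<close>

text \<open>The tail integral of the stopping time: \<open>expo f t 0\<close> is the area of the
  subgraph up to \<open>t\<close>, and the integrand is the probability that it contains no
  atom.\<close>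

definition mean_time :: "(real \<Rightarrow> real) \<Rightarrow> real" where
  "mean_time f = (LINT t:{0..<1}|lborel. exp (- expo f t 0))"

lemma integral_pair_mult:
  fixes a b :: "real \<Rightarrow> real"
  assumes "integrable lborel a" "integrable lborel b"
  shows "integrable lborel (\<lambda>p. a (fst p) * b (snd p))"
    and "(LINT p|lborel. a (fst p) * b (snd p)) = (LINT x|lborel. a x) * (LINT x|lborel. b x)"
proof -
  note i = integrable_pair_mult[OF assms]
  show "integrable lborel (\<lambda>p. a (fst p) * b (snd p))"
    using i by (simp add: lborel_prod case_prod_unfold)
  show "(LINT p|lborel. a (fst p) * b (snd p)) = (LINT x|lborel. a x) * (LINT x|lborel. b x)"
    using lborel_pair.integral_fst'[OF i] by (simp add: lborel_prod case_prod_unfold)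
qed

lemma expo_section_measurable:
  assumes "curve f" shows "(\<lambda>t. expo f t x) \<in> borel_measurable borel"
proof -
  have "(\<lambda>t. (t, x)) \<in> borel_measurable borel" by (intro borel_measurable_continuous_onI continuous_intros)
  from measurable_compose[OF this expo_measurable[OF assms]] show ?thesis by simp
qed

lemma mean_time_integrable:
  assumes "curve f"
  shows "set_integrable lborel {0..<1} (\<lambda>t. exp (- expo f t 0))"
proof (rule set_integrable_bounded_real[where B=1])
  note [measurable] = expo_section_measurable[OF assms]
  show "(\<lambda>t. exp (- expo f t 0)) \<in> borel_measurable borel" by measurable
  show "\<bar>exp (- expo f t 0)\<bar> \<le> 1" for t using expo_ge[of 0 f t] by simp
qed auto

text \<open>Only the differences \<open>f s - x\<close> enter the excess, so a common shift affects
  the linear term alone.\<close>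

lemma expo_shift:
  assumes "\<And>s. 0 \<le> s \<Longrightarrow> s < 1 \<Longrightarrow> g s = f s + e" "t < 1"
  shows "expo g t (x + e) = expo f t x + e"
  unfolding expo_def using assms
  by (subst set_lebesgue_integral_cong[where g="\<lambda>s. max (f s - x) 0"]) auto

lemma integral_translate:
  fixes h :: "'a::euclidean_space \<Rightarrow> real"
  assumes "integrable lborel h"
  shows "integrable lborel (\<lambda>p. h (c + p)) \<and> (LINT p|lborel. h (c + p)) = (LINT p|lborel. h p)"
proof -
  have h: "h \<in> borel_measurable borel" using borel_measurable_integrable[OF assms] by simp
  have T: "(+) c \<in> measurable lborel borel" by simp
  have "integrable (distr lborel borel ((+) c)) h" using assms by (simp only: lborel_distr_plus)
  then have "integrable lborel (\<lambda>p. h (c + p))" by (simp only: integrable_distr_eq[OF T h])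
  moreover have "(LINT p|lborel. h (c + p)) = (LINT p|distr lborel borel ((+) c). h p)"
    by (rule integral_distr[OF T h, symmetric])
  ultimately show ?thesis by (simp only: lborel_distr_plus simp_thms)
qed

text \<open>In coordinates moved down by \<open>e\<close>, the raised subgraph is the old one plus a
  layer of scores in \<open>[-e, 0)\<close>. The factor \<open>exp e\<close> restores the old
  density on the old part. In the layer the exponent falls short of its value at score 0 by at most
  \<open>e\<close>, which gives the two bounds in terms of \<open>v\<close>.\<close>

lemma win_density_shift:
  assumes f: "curve f" and e: "0 \<le> e" and eq: "\<And>s. 0 \<le> s \<Longrightarrow> s < 1 \<Longrightarrow> g s = f s + e"
  defines "v \<equiv> \<lambda>p. (indicator {0..<1} (fst p) * exp (- expo f (fst p) 0)) * indicator {-e..<0} (snd p)"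
    and "w \<equiv> \<lambda>p. exp e * win_density g ((0, e) + p)"
  shows "win_density f p + v p \<le> w p \<and> w p \<le> win_density f p + exp e * v p"
proof -
  obtain t x where p: "p = (t, x)" by (cases p)
  show ?thesis
  proof (cases "0 \<le> t \<and> t < 1 \<and> - e \<le> x \<and> x \<le> f t")
    case True
    then have w: "w p = exp (- expo f t x)"
      using expo_shift[of g f e t x] eq
      by (simp add: w_def p win_density_def subgraph_def exp_add[symmetric] add.commute)
    show ?thesis
    proof (cases "0 \<le> x")
      case True
      then show ?thesis
        using \<open>0 \<le> t \<and> t < 1 \<and> - e \<le> x \<and> x \<le> f t\<close>
        unfolding w by (simp add: p win_density_def subgraph_def v_def)
    next
      case False
      then have v: "v p = exp (- expo f t 0)" and d: "win_density f p = 0"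
        using True by (auto simp: p win_density_def subgraph_def v_def)
      have "expo f t x \<le> expo f t 0" "expo f t 0 - expo f t x \<le> e"
        using expo_mono_score[OF f, of t x 0] True False by auto
      then show ?thesis
        unfolding w v d by (simp add: exp_add[symmetric])
    qed
  next
    case False
    then have "w p = 0" "win_density f p = 0"
      using eq[of t] e by (auto simp: p w_def win_density_def subgraph_def)
    moreover have "v p = 0"
      using False curve_nonneg[OF f, of t] by (auto simp: p v_def indicator_def)
    ultimately show ?thesis by simp
  qed
qed

text \<open>The lower bound serves the case that \<open>f\<close> is optimal and raised to
  \<open>g\<close>, the upper bound the case that \<open>g\<close> is optimal and \<open>f\<close>
  is its lowered version.\<close>

lemma win_integral_shift:
  assumes f: "curve f" and g: "curve g" and e: "0 \<le> e"
    and eq: "\<And>s. 0 \<le> s \<Longrightarrow> s < 1 \<Longrightarrow> g s = f s + e"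
  shows "win_integral f + e * mean_time f \<le> exp e * win_integral g \<and>
    exp e * win_integral g \<le> win_integral f + e * exp e * mean_time f"
proof -
  define a where "a t = indicator {0..<1} t * exp (- expo f t 0)" for t
  define v where "v p = a (fst p) * indicator {-e..<0} (snd p)" for p :: "real \<times> real"
  define w where "w p = exp e * win_density g ((0, e) + p)" for p
  note i = integral_translate[OF win_density_integrable[OF g], of "(0, e)"]
  have w_int: "integrable lborel w" using i by (simp add: w_def[abs_def])
  have w_val: "(LINT p|lborel. w p) = exp e * win_integral g"
    using i by (simp add: w_def win_integral_def)
  have a_int: "integrable lborel a"
    using mean_time_integrable[OF f] by (simp add: set_integrable_def a_def[abs_def])
  have b_int: "integrable lborel (indicator {-e..<0} :: real \<Rightarrow> real)"
    by (rule integrable_real_indicator) (use e in auto)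
  have v_int: "integrable lborel v"
    using integral_pair_mult(1)[OF a_int b_int] by (simp add: v_def[abs_def])
  have v_val: "(LINT p|lborel. v p) = e * mean_time f"
    using integral_pair_mult(2)[OF a_int b_int] e
    by (simp add: v_def a_def mean_time_def set_lebesgue_integral_def)
  note d_int = win_density_integrable[OF f]
  note wv = win_density_shift[OF f e eq, folded a_def, folded v_def w_def]
  have "(LINT p|lborel. win_density f p + v p) \<le> (LINT p|lborel. w p)"
    by (rule integral_mono[OF Bochner_Integration.integrable_add[OF d_int v_int] w_int]) (use wv in simp)
  moreover have "(LINT p|lborel. w p) \<le> (LINT p|lborel. win_density f p + exp e * v p)"
    by (rule integral_mono[OF w_int Bochner_Integration.integrable_add[OF d_int integrable_mult_right[OF v_int]]])
      (use wv in simp)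
  ultimately show ?thesis
    using d_int v_int v_val by (simp add: win_integral_def w_val mult.left_commute mult.assoc)
qed

lemma mean_time_optimal:
  assumes f: "curve f" and opt: "\<And>f'. curve f' \<Longrightarrow> win_integral f' \<le> win_integral f"
  shows "mean_time f = win_integral f"
proof (rule antisym)
  define v where "v = win_integral f"
  have v: "0 \<le> v"
    unfolding v_def win_integral_def by (simp add: win_density_nonneg integral_nonneg)
  have up: "mean_time f \<le> v + e * v" if "0 < e" "e \<le> 1" for e
  proof -
    define g where "g s = (if s \<in> {0..<1} then f s + e else 0)" for s
    have g: "curve g"
      unfolding g_def by (rule curve_compose[OF f, of "\<lambda>x. x + e"])
        (use that in \<open>auto intro!: continuous_intros simp: mono_def\<close>)
    have "v + e * mean_time f \<le> exp e * win_integral g"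
      unfolding v_def by (rule win_integral_shift[OF f g, THEN conjunct1]) (use that in \<open>auto simp: g_def\<close>)
    also have "\<dots> \<le> exp e * v"
      unfolding v_def by (intro mult_left_mono opt g) auto
    \<comment> \<open>A second-order bound is accurate enough: after cancelling \<open>v\<close> and
      dividing by \<open>e\<close> the error is \<open>e * v\<close>.\<close>
    also have "\<dots> \<le> (1 + e + e\<^sup>2) * v"
      by (intro mult_right_mono exp_bound v) (use that in auto)
    finally have "e * mean_time f \<le> e * (v + e * v)" by (simp add: algebra_simps power2_eq_square)
    then show ?thesis using that by simp
  qed
  show "mean_time f \<le> win_integral f"
  proof (rule field_le_epsilon)
    fix \<delta> :: real assume \<delta>: "0 < \<delta>"
    have "min 1 (\<delta> / (v + 1)) * v \<le> \<delta> / (v + 1) * (v + 1)"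
      by (intro mult_mono) (use \<delta> v in auto)
    also have "\<dots> = \<delta>" using v by simp
    finally show "mean_time f \<le> win_integral f + \<delta>"
      using up[of "min 1 (\<delta> / (v + 1))"] \<delta> v by (simp add: v_def)
  qed
  \<comment> \<open>With \<open>f 0 = 0\<close> the gain at time 0 would be 1, against the
    first-order condition.\<close>
  have f0: "0 < f 0"
    using gain_optimal[OF f opt, of 0] win_mass_zero[OF f, of 0] curve_nonneg[OF f, of 0]
    by (cases "f 0 = 0") (auto simp: gain_def)
  have down: "v * (1 - 2 * e) \<le> mean_time f" if "0 < e" "e \<le> f 0" for e
  proof -
    define g where "g s = (if s \<in> {0..<1} then max (f s - e) 0 else 0)" for s
    have g: "curve g"
      unfolding g_def by (rule curve_compose[OF f, of "\<lambda>x. max (x - e) 0"])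
        (auto intro!: continuous_intros simp: mono_def)
    \<comment> \<open>Since \<open>e <= f 0 <= f s\<close>, the truncation at 0 never acts, and
      \<open>f\<close> is exactly \<open>g\<close> raised by \<open>e\<close>.\<close>
    have eq: "f s = g s + e" if "0 \<le> s" "s < 1" for s
      using curve_mono[OF f that] \<open>e \<le> f 0\<close> that by (simp add: g_def)
    have "exp e * v \<le> win_integral g + e * exp e * mean_time g"
      unfolding v_def by (rule win_integral_shift[OF g f, THEN conjunct2]) (use that eq in auto)
    \<comment> \<open>The tail integral of the lowered curve is traded for that of \<open>f\<close>
      at the price of a factor \<open>exp e\<close>. With the factor from the shift this makes
      \<open>exp (2 * e)\<close>, which tends to 1.\<close>
    also have "mean_time g \<le> (LINT t:{0..<1}|lborel. exp e * exp (- expo f t 0))"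
      unfolding mean_time_def
    proof (rule set_integral_mono)
      show "set_integrable lborel {0..<1} (\<lambda>t. exp (- expo g t 0))"
        by (rule mean_time_integrable[OF g])
      show "set_integrable lborel {0..<1} (\<lambda>t. exp e * exp (- expo f t 0))"
        by (intro set_integrable_mult_right mean_time_integrable[OF f])
      fix t :: real assume t: "t \<in> {0..<1}"
      have "expo f t e = expo g t 0 + e"
        using expo_shift[of f g e t 0] eq t by simp
      moreover have "expo f t 0 \<le> expo f t e"
        by (rule expo_mono_score(1)[OF f]) (use t that in auto)
      ultimately show "exp (- expo g t 0) \<le> exp e * exp (- expo f t 0)"
        by (simp add: exp_add[symmetric])
    qed
    also have "\<dots> = exp e * mean_time f" by (simp add: mean_time_def)
    also have "win_integral g \<le> v" unfolding v_def by (rule opt[OF g])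
    finally have "exp e * v \<le> v + e * exp e * (exp e * mean_time f)"
      using that by (simp add: mult_left_mono)
    moreover have "(1 + e) * v \<le> exp e * v"
      by (intro mult_right_mono v exp_ge_add_one_self)
    moreover have "exp (2 * e) = exp e * exp e" by (simp add: exp_add[symmetric])
    ultimately have "e * v \<le> e * (exp (2 * e) * mean_time f)"
      by (simp add: algebra_simps)
    then have "v \<le> exp (2 * e) * mean_time f" using that by simp
    then have "exp (- (2 * e)) * v \<le> exp (- (2 * e)) * (exp (2 * e) * mean_time f)"
      by (intro mult_left_mono) auto
    also have "\<dots> = mean_time f" by (simp add: mult.assoc[symmetric] exp_add[symmetric])
    finally have "exp (- (2 * e)) * v \<le> mean_time f" .
    moreover have "(1 - 2 * e) * v \<le> exp (- (2 * e)) * v"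
      using exp_ge_add_one_self[of "- (2 * e)"] by (intro mult_right_mono v) linarith
    ultimately show ?thesis by (simp add: mult.commute)
  qed
  show "win_integral f \<le> mean_time f"
  proof (rule field_le_epsilon)
    fix \<delta> :: real assume \<delta>: "0 < \<delta>"
    define e where "e = min (f 0) (\<delta> / (2 * (v + 1)))"
    have "2 * e * v \<le> 2 * (\<delta> / (2 * (v + 1))) * (v + 1)"
      by (intro mult_mono) (use \<delta> v f0 in \<open>auto simp: e_def\<close>)
    also have "\<dots> = \<delta>" using v by (simp add: field_simps)
    finally show "win_integral f \<le> mean_time f + \<delta>"
      using down[of e] \<delta> v f0 by (simp add: v_def[symmetric] e_def algebra_simps)
  qed
qed

section \<open>Decomposition of the exponent through the generalised inverse\<close>

lemma gen_inverse_eq_measure: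
  assumes f: "curve f" and u: "u < 1" and z: "z \<le> f u"
  shows "gen_inverse f z = (LINT s:{0..<u}|lborel. indicator {s. f s < z} s)"
proof -
  have [measurable]: "f \<in> borel_measurable borel" using f by measurable
  define B where "B = {t\<in>{0..<1}. f t < z}"
  have gi: "gen_inverse f z = (if B = {} then 0 else Sup B)"
    by (simp only: gen_inverse_def B_def)
  \<comment> \<open>From time \<open>u\<close> on the curve is at least \<open>z\<close>, so cutting
    at \<open>u\<close> loses nothing of the sublevel set.\<close>
  have B_u: "B \<subseteq> {0..<u}"
  proof
    fix t assume "t \<in> B"
    with curve_mono[OF f, of u t] z show "t \<in> {0..<u}" by (cases "u \<le> t") (auto simp: B_def)
  qed
  have B_m: "B \<in> sets borel" unfolding B_def by measurable
  have "(LINT s:{0..<u}|lborel. indicator {s. f s < z} s) = (LINT s|lborel. indicator B s)"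
    unfolding set_lebesgue_integral_def
    by (rule Bochner_Integration.integral_cong) (use B_u u in \<open>auto simp: B_def indicator_def\<close>)
  also have "\<dots> = measure lborel B" by simp
  also have "\<dots> = gen_inverse f z"
  proof (cases "B = {}")
    case True
    then show ?thesis by (simp add: gi)
  next
    case False
    define g where "g = Sup B"
    have bdd: "bdd_above B" using B_u by (meson bdd_above_Ico bdd_above_mono)
    have g0: "0 \<le> g"
    proof -
      obtain b where "b \<in> B" using False by auto
      then show ?thesis using cSup_upper[OF _ bdd, of b] by (auto simp: g_def B_def)
    qed
    \<comment> \<open>By monotonicity the sublevel set is an initial segment of
      \<open>[0,1)\<close>, with or without its right end, so its supremum is its length.\<close>
    have sub: "{0..<g} \<subseteq> B" "B \<subseteq> {0..g}"
    proof -
      show "B \<subseteq> {0..g}" using cSup_upper[OF _ bdd] by (auto simp: g_def B_def)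
      show "{0..<g} \<subseteq> B"
      proof
        fix s assume s: "s \<in> {0..<g}"
        then obtain b where b: "b \<in> B" "s < b"
          using False less_cSup_iff[OF False bdd] by (auto simp: g_def)
        with curve_mono[OF f, of s b] s show "s \<in> B" by (auto simp: B_def)
      qed
    qed
    have "B \<in> fmeasurable lborel"
      using B_m emeasure_bounded_finite[OF bounded_subset[OF bounded_closed_interval sub(2)]]
      by (auto intro: fmeasurableI)
    then have "measure lborel {0..<g} \<le> measure lborel B"
      by (intro measure_mono_fmeasurable[OF sub(1)]) auto
    moreover have "measure lborel B \<le> measure lborel {0..g}"
      using B_m g0 by (intro measure_mono_fmeasurable[OF sub(2)]) (auto intro: fmeasurableI)
    ultimately have "measure lborel B = g" using g0 by simp
    then show ?thesis using False by (simp add: gi g_def)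
  qed
  finally show ?thesis by simp
qed

lemma set_integral_Ico_eq_Icc:
  fixes h :: "real \<Rightarrow> real"
  assumes [measurable]: "h \<in> borel_measurable borel"
  shows "(LINT s:{a..<b}|lborel. h s) = (LINT s:{a..b}|lborel. h s)"
proof -
  have "AE s in lborel. s \<noteq> b" by (rule AE_lborel_singleton)
  then show ?thesis
    unfolding set_lebesgue_integral_def
    by (intro integral_cong_AE) (use assms in \<open>auto simp: indicator_def\<close>)
qed

text \<open>Fubini for the area of the points \<open>(s, z)\<close> with \<open>f s < z <= x\<close>
  and \<open>s < u\<close>: horizontal slices have length \<open>gen_inverse f z\<close>, vertical
  ones the positive part. The bound \<open>x <= f u\<close> ensures that no horizontal slice is cut
  off at \<open>u\<close>.\<close>

lemma inverse_integral_eq: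
  assumes f: "curve f" and u: "0 \<le> u" "u < 1" and x: "0 \<le> x" "x \<le> f u"
  shows "inverse_integral f x = (LINT s:{0..<u}|lborel. max (x - f s) 0)"
proof -
  have [measurable]: "f \<in> borel_measurable borel" using f by measurable
  define k where "k z s = (if 0 \<le> z \<and> z \<le> x \<and> 0 \<le> s \<and> s < u \<and> f s < z then 1 else 0 :: real)" for z s
  have k_int: "integrable (lborel \<Otimes>\<^sub>M lborel) (\<lambda>(z, s). k z s)"
  proof (rule Bochner_Integration.integrable_bound)
    show "integrable (lborel \<Otimes>\<^sub>M lborel) (\<lambda>(z, s). indicator {0..x} z * indicator {0..<u} s :: real)"
      by (rule integrable_pair_mult) (use x u in auto)
    show "(\<lambda>(z, s). k z s) \<in> borel_measurable (lborel \<Otimes>\<^sub>M lborel)"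
      unfolding k_def by measurable
  qed (auto simp: k_def indicator_def)
  have "inverse_integral f x = (LINT z|lborel. LINT s|lborel. k z s)"
    unfolding inverse_integral_def set_lebesgue_integral_def
  proof (rule Bochner_Integration.integral_cong)
    fix z
    have "k z s = indicator {0..x} z * (indicator {0..<u} s * indicator {s. f s < z} s)" for s
      by (auto simp: k_def indicator_def)
    then have "(LINT s|lborel. k z s) = indicator {0..x} z * (LINT s:{0..<u}|lborel. indicator {s. f s < z} s)"
      by (simp add: set_lebesgue_integral_def)
    then show "indicator {0..x} z *\<^sub>R gen_inverse f z = (LINT s|lborel. k z s)"
      using gen_inverse_eq_measure[OF f u(2), of z] x by (auto simp: indicator_def)
  qed simp
  also have "\<dots> = (LINT s|lborel. LINT z|lborel. k z s)"
    using lborel_pair.Fubini_integral[OF k_int] by simp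
  also have "\<dots> = (LINT s:{0..<u}|lborel. max (x - f s) 0)"
    unfolding set_lebesgue_integral_def
  proof (rule Bochner_Integration.integral_cong)
    fix s
    have "k z s = indicator {0..<u} s * indicator {f s<..x} z" for z
      using curve_nonneg[OF f, of s] by (auto simp: k_def indicator_def)
    then show "(LINT z|lborel. k z s) = indicator {0..<u} s *\<^sub>R max (x - f s) 0"
      by (cases "f s \<le> x") auto
  qed simp
  finally show ?thesis .
qed

lemma curve_set_integrable:
  assumes f: "curve f" and u: "u < 1"
  shows "set_integrable lborel {0..<u} f"
  by (rule set_integrable_bounded_real[where B="f u"])
    (use f curve_mono[OF f _ u] curve_nonneg[OF f] in auto)

lemma curve_integral_eq_expo:
  assumes f: "curve f"
  shows "curve_integral f u = expo f u 0"
proof -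
  have "(LINT s:{0..<u}|lborel. max (f s) 0) = (LINT s:{0..<u}|lborel. f s)"
    using curve_nonneg[OF f] by (simp add: max_absorb1)
  then show ?thesis
    using set_integral_Ico_eq_Icc[of f 0 u] f
    by (simp add: curve_integral_def expo_def curve_measurable)
qed

text \<open>From \<open>max (f s - x) 0 = (f s - x) + max (x - f s) 0\<close>: the pieces integrate
  to F(u), -xu and G(x), and -xu combines with the area \<open>x\<close> of the slab.\<close>

lemma expo_eq:
  assumes f: "curve f" and u: "0 \<le> u" "u < 1" and x: "0 \<le> x" "x \<le> f u"
  shows "expo f u x = curve_integral f u + x * (1 - u) + inverse_integral f x"
proof -
  have [measurable]: "f \<in> borel_measurable borel" using f by measurable
  have i1: "set_integrable lborel {0..<u} (\<lambda>s. f s - x)"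
    by (intro set_integral_diff(1) curve_set_integrable[OF f u(2)] set_integrable_bounded_real) auto
  have i2: "set_integrable lborel {0..<u} (\<lambda>s. max (x - f s) 0)"
    by (rule set_integrable_bounded_real[where B=x]) (use x curve_nonneg[OF f] in auto)
  have "(LINT s:{0..<u}|lborel. max (f s - x) 0) =
    (LINT s:{0..<u}|lborel. (f s - x) + max (x - f s) 0)"
    by (rule set_lebesgue_integral_cong) auto
  also have "\<dots> = (LINT s:{0..<u}|lborel. f s - x) + (LINT s:{0..<u}|lborel. max (x - f s) 0)"
    by (rule set_integral_add(2)[OF i1 i2])
  also have "(LINT s:{0..<u}|lborel. f s - x) = (LINT s:{0..<u}|lborel. f s) - (LINT s:{0..<u}|lborel. x)"
    by (intro set_integral_diff(2) curve_set_integrable[OF f u(2)] set_integrable_bounded_real) auto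
  also have "(LINT s:{0..<u}|lborel. f s) = curve_integral f u"
    using set_integral_Ico_eq_Icc[of f 0 u] f by (simp add: curve_integral_def curve_measurable)
  finally show ?thesis
    using u by (simp add: expo_def inverse_integral_eq[OF f u x] set_integral_const algebra_simps)
qed

text \<open>For \<open>u > t\<close> monotonicity makes \<open>x <= f t\<close> imply
  \<open>x <= f u\<close>, so the region is a rectangle and its mass an iterated integral. The
  endpoint \<open>t\<close> is a null set.\<close>

lemma partial_win_eq_win_mass:
  assumes f: "curve f" and t: "0 \<le> t" "t < 1"
  shows "partial_win f t = win_mass f t (f t)"
proof -
  have i: "integrable (lborel \<Otimes>\<^sub>M lborel) (\<lambda>p. indicator ({t<..} \<times> {..f t}) p * win_density f p)"
    using win_mass_integrable[OF f] by (simp add: lborel_prod)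
  define r where "r u = (LINT x:{0..f t}|lborel. exp (- expo f u x))" for u
  have r_meas: "r \<in> borel_measurable borel"
  proof -
    have [measurable]: "(\<lambda>p. expo f (fst p) (snd p)) \<in> borel_measurable (borel \<Otimes>\<^sub>M borel)"
      using expo_measurable[OF f] by (simp add: borel_prod)
    have "(\<lambda>p. indicator {0..f t} (snd p) *\<^sub>R exp (- expo f (fst p) (snd p))) \<in> borel_measurable (borel \<Otimes>\<^sub>M lborel)"
      by measurable
    then have "(\<lambda>u. LINT x|lborel. indicator {0..f t} x *\<^sub>R exp (- expo f u x)) \<in> borel_measurable borel"
      by (intro lborel.borel_measurable_lebesgue_integral) (simp add: case_prod_unfold)
    then show ?thesis by (simp add: r_def[abs_def] set_lebesgue_integral_def)
  qed
  have "win_mass f t (f t) = (LINT u|lborel. LINT x|lborel. indicator ({t<..} \<times> {..f t}) (u, x) * win_density f (u, x))"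
    unfolding win_mass_def using lborel_pair.integral_fst'[OF i] by (simp add: lborel_prod)
  also have "\<dots> = (LINT u:{t<..<1}|lborel. r u)"
    unfolding set_lebesgue_integral_def[of _ "{t<..<1}"]
  proof (rule Bochner_Integration.integral_cong)
    fix u
    have "indicator ({t<..} \<times> {..f t}) (u, x) * win_density f (u, x)
        = indicator {t<..<1} u * (indicator {0..f t} x * exp (- expo f u x))" for x
      using t curve_mono[OF f, of t u] by (auto simp: win_density_def subgraph_def indicator_def)
    then show "(LINT x|lborel. indicator ({t<..} \<times> {..f t}) (u, x) * win_density f (u, x))
        = indicator {t<..<1} u *\<^sub>R r u"
      by (simp add: r_def set_lebesgue_integral_def)
  qed simp
  also have "\<dots> = (LINT u:{t..<1}|lborel. r u)"
    unfolding set_lebesgue_integral_def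
    by (intro integral_cong_AE) (use r_meas AE_lborel_singleton[of t] in \<open>auto simp: indicator_def\<close>)
  also have "\<dots> = partial_win f t"
    unfolding partial_win_def
  proof (rule set_lebesgue_integral_cong)
    show "\<forall>u. u \<in> {t..<1} \<longrightarrow> r u = exp (- curve_integral f u) *
        (LINT x:{0..f t}|lborel. exp (- x * (1 - u) - inverse_integral f x))"
    proof (intro allI impI)
      fix u assume u: "u \<in> {t..<1}"
      have "r u = (LINT x:{0..f t}|lborel. exp (- curve_integral f u) * exp (- x * (1 - u) - inverse_integral f x))"
        unfolding r_def
      proof (rule set_lebesgue_integral_cong)
        show "\<forall>x. x \<in> {0..f t} \<longrightarrow> exp (- expo f u x) =
          exp (- curve_integral f u) * exp (- x * (1 - u) - inverse_integral f x)"
          using expo_eq[OF f, of u] u t curve_mono[OF f, of t u]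
          by (auto simp: exp_add[symmetric])
      qed simp
      then show "r u = exp (- curve_integral f u) *
        (LINT x:{0..f t}|lborel. exp (- x * (1 - u) - inverse_integral f x))" by simp
    qed
  qed simp
  finally show ?thesis by simp
qed

section \<open>Poisson configurations\<close>

lemma fmeasurable_rectangle:
  fixes a b c d :: real
  assumes "a \<le> b" "c \<le> d"
  shows "{a..b} \<times> {c..d} \<in> fmeasurable lborel"
  by (rule fmeasurableI) (auto simp: emeasure_rectangle assms)

section \<open>Void and count probabilities\<close>

context unit_poisson_process
begin

definition observable :: "(real \<times> real) set \<Rightarrow> bool" where
  "observable B \<longleftrightarrow> B \<in> sets borel \<and> bounded B \<and> B \<subseteq> strip"

lemma observable_Un: "observable B \<Longrightarrow> observable C \<Longrightarrow> observable (B \<union> C)"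
  by (auto simp: observable_def)

lemma observable_subset: "observable B \<Longrightarrow> C \<in> sets borel \<Longrightarrow> C \<subseteq> B \<Longrightarrow> observable C"
  by (auto simp: observable_def intro: bounded_subset)

lemma finite_atoms: "observable B \<Longrightarrow> \<omega> \<in> space M \<Longrightarrow> finite (\<Phi> \<omega> \<inter> B)"
  using locally_finite by (auto simp: observable_def)

lemma count_event [measurable]:
  assumes "observable B"
  shows "{\<omega> \<in> space M. P (card (\<Phi> \<omega> \<inter> B))} \<in> events"
proof -
  have "(\<lambda>\<omega>. card (\<Phi> \<omega> \<inter> B)) \<in> M \<rightarrow>\<^sub>M count_space UNIV"
    using assms count_measurable by (auto simp: observable_def)
  from measurable_sets[OF this, of "{k. P k}"] show ?thesis
    by (simp add: vimage_def Int_def conj_commute)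
qed

lemma void_eq:
  assumes "observable B"
  shows "{\<omega> \<in> space M. \<Phi> \<omega> \<inter> B = {}} = {\<omega> \<in> space M. card (\<Phi> \<omega> \<inter> B) = 0}"
  using finite_atoms[OF assms] by auto

lemma void_event: "observable B \<Longrightarrow> {\<omega> \<in> space M. \<Phi> \<omega> \<inter> B = {}} \<in> events"
  unfolding void_eq by (rule count_event)

lemma prob_void:
  assumes "observable B"
  shows "prob {\<omega> \<in> space M. \<Phi> \<omega> \<inter> B = {}} = exp (- measure lborel B)"
  unfolding void_eq[OF assms] using assms count_poisson[of B 0] by (auto simp: observable_def)

text \<open>Disjointness makes the two counts independent. The exact value serves the lower bound on
  the probability of winning in a cell.\<close>

lemma prob_one_void:
  assumes B: "observable B" and C: "observable C" and disj: "B \<inter> C = {}"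
  shows "prob {\<omega> \<in> space M. card (\<Phi> \<omega> \<inter> B) = 1 \<and> \<Phi> \<omega> \<inter> C = {}}
    = measure lborel B * exp (- (measure lborel B + measure lborel C))"
proof -
  define D where "D i = (if i = 0 then B else C)" for i :: nat
  have "indep_vars (\<lambda>_. count_space UNIV) (\<lambda>i \<omega>. card (\<Phi> \<omega> \<inter> D i)) {0, 1}"
    by (rule count_indep) (use B C disj in \<open>auto simp: D_def disjoint_family_on_def observable_def\<close>)
  from indep_varsD[OF this, of "{0, 1}" "\<lambda>i. if i = 0 then {1} else {0}"]
  have "prob (\<Inter>i\<in>{0,1}. (\<lambda>\<omega>. card (\<Phi> \<omega> \<inter> D i)) -` (if i = 0 then {1} else {0}) \<inter> space M)
    = (\<Prod>i\<in>{0,1}. prob ((\<lambda>\<omega>. card (\<Phi> \<omega> \<inter> D i)) -` (if i = 0 then {1} else {0}) \<inter> space M))"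
    by simp
  also have "(\<Inter>i\<in>{0,1}. (\<lambda>\<omega>. card (\<Phi> \<omega> \<inter> D i)) -` (if i = 0 then {1} else {0}) \<inter> space M)
    = {\<omega> \<in> space M. card (\<Phi> \<omega> \<inter> B) = 1 \<and> \<Phi> \<omega> \<inter> C = {}}"
    using finite_atoms[OF C] by (auto simp: D_def)
  also have "(\<Prod>i\<in>{0,1}. prob ((\<lambda>\<omega>. card (\<Phi> \<omega> \<inter> D i)) -` (if i = 0 then {1} else {0}) \<inter> space M))
    = prob {\<omega> \<in> space M. card (\<Phi> \<omega> \<inter> B) = 1} * prob {\<omega> \<in> space M. card (\<Phi> \<omega> \<inter> C) = 0}"
    by (simp add: D_def vimage_def Int_def conj_commute)
  also have "\<dots> = measure lborel B * exp (- (measure lborel B + measure lborel C))"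
    using B C count_poisson[of B 1] count_poisson[of C 0]
    by (simp add: observable_def exp_add[symmetric])
  finally show ?thesis .
qed

text \<open>The event is a difference of two void events, so overlapping \<open>B\<close> and
  \<open>C\<close> are covered too; convexity of the exponential supplies the linear factor. This is
  the counterpart of \<open>prob_one_void\<close> for upper bounds.\<close>

lemma prob_hit_void:
  assumes B: "observable B" and C: "observable C"
  shows "prob {\<omega> \<in> space M. \<Phi> \<omega> \<inter> B \<noteq> {} \<and> \<Phi> \<omega> \<inter> C = {}} \<le> measure lborel B * exp (- measure lborel C)"
proof -
  let ?b = "measure lborel B" and ?c = "measure lborel C"
  have "{\<omega> \<in> space M. \<Phi> \<omega> \<inter> B \<noteq> {} \<and> \<Phi> \<omega> \<inter> C = {}}
    = {\<omega> \<in> space M. \<Phi> \<omega> \<inter> C = {}} - {\<omega> \<in> space M. \<Phi> \<omega> \<inter> (B \<union> C) = {}}"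
    by auto
  moreover have "prob ({\<omega> \<in> space M. \<Phi> \<omega> \<inter> C = {}} - {\<omega> \<in> space M. \<Phi> \<omega> \<inter> (B \<union> C) = {}})
    = prob {\<omega> \<in> space M. \<Phi> \<omega> \<inter> C = {}} - prob {\<omega> \<in> space M. \<Phi> \<omega> \<inter> (B \<union> C) = {}}"
    by (rule finite_measure_Diff) (auto intro: void_event B C observable_Un)
  ultimately have "prob {\<omega> \<in> space M. \<Phi> \<omega> \<inter> B \<noteq> {} \<and> \<Phi> \<omega> \<inter> C = {}}
    = exp (- ?c) - exp (- measure lborel (B \<union> C))"
    by (simp only: prob_void[OF C] prob_void[OF observable_Un[OF B C]])
  moreover have "measure lborel (B \<union> C) \<le> ?b + ?c"
    using B C by (intro measure_Un_le) (auto simp: observable_def)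
  then have "exp (- ?c) * exp (- ?b) \<le> exp (- measure lborel (B \<union> C))"
    by (simp add: exp_add[symmetric])
  moreover have "exp (- ?c) * (1 - ?b) \<le> exp (- ?c) * exp (- ?b)"
    using exp_ge_add_one_self[of "- ?b"] by (intro mult_left_mono) auto
  ultimately show ?thesis by (simp add: algebra_simps)
qed

text \<open>The bound is quadratic in the area, so a union over about n sets of area of order 1/n
  becomes negligible.\<close>

lemma prob_two_atoms:
  assumes B: "observable B"
  shows "prob {\<omega> \<in> space M. 2 \<le> card (\<Phi> \<omega> \<inter> B)} \<le> (measure lborel B)\<^sup>2"
proof -
  let ?b = "measure lborel B"
  let ?E = "\<lambda>k. {\<omega> \<in> space M. card (\<Phi> \<omega> \<inter> B) = k}"
  have "{\<omega> \<in> space M. 2 \<le> card (\<Phi> \<omega> \<inter> B)} = space M - (?E 0 \<union> ?E 1)"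
    by auto
  then have "prob {\<omega> \<in> space M. 2 \<le> card (\<Phi> \<omega> \<inter> B)} = 1 - prob (?E 0 \<union> ?E 1)"
    by (simp add: prob_compl count_event B sets.Un)
  also have "prob (?E 0 \<union> ?E 1) = prob (?E 0) + prob (?E 1)"
    by (rule finite_measure_Union) (auto intro: count_event B)
  also have "\<dots> = exp (- ?b) * (1 + ?b)"
    using B count_poisson[of B 0] count_poisson[of B 1] by (simp add: observable_def algebra_simps)
  also have "1 - exp (- ?b) * (1 + ?b) \<le> ?b\<^sup>2"
  proof -
    have "(1 - ?b) * (1 + ?b) \<le> exp (- ?b) * (1 + ?b)"
      using exp_ge_add_one_self[of "- ?b"] by (intro mult_right_mono) auto
    then show ?thesis by (simp add: algebra_simps power2_eq_square)
  qed
  finally show ?thesis by simp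
qed

section \<open>Almost sure properties of the atoms\<close>

lemma AE_of_null_bound:
  assumes E: "\<And>n::nat. E n \<in> events" and le: "\<And>n. prob (E n) \<le> C / real (Suc n)"
  shows "AE \<omega> in M. \<exists>n. \<omega> \<notin> E n"
proof -
  have m: "(\<Inter>n. E n) \<in> events" using E by auto
  have "prob (\<Inter>n. E n) \<le> C / real (Suc n)" for n
    using finite_measure_mono[of "\<Inter>n. E n" "E n"] E[of n] le[of n] by fastforce
  moreover have "(\<lambda>n. C / real (Suc n)) \<longlonglongrightarrow> 0"
    by (rule LIMSEQ_Suc[OF lim_const_over_n])
  ultimately have "prob (\<Inter>n. E n) \<le> 0" by (intro LIMSEQ_le_const) auto
  then have "prob (\<Inter>n. E n) = 0" by (simp add: measure_le_0_iff)
  then have "AE \<omega> in M. \<omega> \<notin> (\<Inter>n. E n)" using prob_eq_0[OF m] by simp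
  then show ?thesis by simp
qed

definition layer :: "real \<Rightarrow> (real \<times> real) set" where
  "layer k = {0..1} \<times> {0..k}"

lemma layer_observable: "observable (layer k)"
  by (auto simp: observable_def layer_def strip_def bounded_Times)

lemma strip_subset_layer: "p \<in> strip \<Longrightarrow> snd p \<le> k \<Longrightarrow> p \<in> layer k"
  by (auto simp: layer_def strip_def)

text \<open>The law is prescribed on bounded sets only; an unbounded null set is exhausted by
  countably many layers.\<close>

lemma AE_no_atoms:
  assumes B: "B \<in> sets borel" "B \<subseteq> strip" "\<And>k::nat. measure lborel (B \<inter> layer k) = 0"
  shows "AE \<omega> in M. \<Phi> \<omega> \<inter> B = {}"
proof -
  have "AE \<omega> in M. \<Phi> \<omega> \<inter> (B \<inter> layer k) = {}" for k :: nat
  proof -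
    have o: "observable (B \<inter> layer k)"
      using layer_observable B by (auto intro!: observable_subset[OF layer_observable] sets.Int simp: observable_def)
    from prob_void[OF this] B(3)[of k] have "prob {\<omega> \<in> space M. \<Phi> \<omega> \<inter> (B \<inter> layer k) = {}} = 1" by simp
    then show ?thesis using AE_prob_1 by force
  qed
  then have "AE \<omega> in M. \<forall>k::nat. \<Phi> \<omega> \<inter> (B \<inter> layer k) = {}" by (simp add: AE_all_countable)
  then show ?thesis
  proof (rule AE_mp, intro AE_I2 impI)
    fix \<omega> assume *: "\<forall>k::nat. \<Phi> \<omega> \<inter> (B \<inter> layer k) = {}"
    show "\<Phi> \<omega> \<inter> B = {}"
    proof (rule ccontr)
      assume "\<Phi> \<omega> \<inter> B \<noteq> {}"
      then obtain p where "p \<in> \<Phi> \<omega>" "p \<in> B" by auto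
      moreover obtain k :: nat where "snd p \<le> k" using real_arch_simple by blast
      ultimately show False using * strip_subset_layer[of p k] B(2) by blast
    qed
  qed
qed

lemma AE_atom: "AE \<omega> in M. \<Phi> \<omega> \<noteq> {}"
proof -
  have "AE \<omega> in M. \<exists>n. \<omega> \<notin> {\<omega> \<in> space M. \<Phi> \<omega> \<inter> layer (real n) = {}}"
  proof (rule AE_of_null_bound[where C=1])
    fix n
    show "{\<omega> \<in> space M. \<Phi> \<omega> \<inter> layer (real n) = {}} \<in> events"
      by (rule void_event[OF layer_observable])
    have "measure lborel (layer (real n)) = real n"
      unfolding layer_def by (simp add: measure_def emeasure_rectangle)
    then have "prob {\<omega> \<in> space M. \<Phi> \<omega> \<inter> layer (real n) = {}} = exp (- real n)"
      using prob_void[OF layer_observable] by simp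
    also have "\<dots> \<le> 1 / real (Suc n)"
      using exp_ge_add_one_self[of "real n"] by (simp add: exp_minus divide_simps)
    finally show "prob {\<omega> \<in> space M. \<Phi> \<omega> \<inter> layer (real n) = {}} \<le> 1 / real (Suc n)" .
  qed
  then show ?thesis by (rule AE_mp) (auto intro!: AE_I2)
qed

text \<open>Cut into slabs of width \<open>1 / (n + 1)\<close>: some slab contains two atoms with probability \<open>O(1 / n)\<close>.\<close>

lemma AE_no_ties:
  fixes \<pi> :: "real \<times> real \<Rightarrow> real"
  assumes \<pi>: "\<pi> \<in> borel_measurable borel"
    and range: "\<And>k p. 1 \<le> k \<Longrightarrow> p \<in> layer k \<Longrightarrow> 0 \<le> \<pi> p \<and> \<pi> p \<le> k"
    and slab: "\<And>k a b. 1 \<le> k \<Longrightarrow> a \<le> b \<Longrightarrow> measure lborel (layer k \<inter> \<pi> -` {a..b}) \<le> (b - a) * k"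
  shows "AE \<omega> in M. inj_on \<pi> (\<Phi> \<omega>)"
proof -
  have "AE \<omega> in M. inj_on \<pi> (\<Phi> \<omega> \<inter> layer (Suc k))" for k :: nat
  proof -
    let ?k = "real (Suc k)"
    define S where "S n i = layer ?k \<inter> \<pi> -` {real i / real (Suc n)..real (Suc i) / real (Suc n)}" for n i :: nat
    have S_obs: "observable (S n i)" for n i
      using measurable_sets[OF \<pi>, of "{real i / real (Suc n)..real (Suc i) / real (Suc n)}"] layer_observable[of ?k]
      by (intro observable_subset[OF layer_observable[of ?k]]) (auto simp: S_def observable_def)
    have S_le: "measure lborel (S n i) \<le> ?k / real (Suc n)" for n i
    proof -
      have "measure lborel (S n i) \<le> (real (Suc i) / real (Suc n) - real i / real (Suc n)) * ?k"
        unfolding S_def by (rule slab) (auto simp: divide_right_mono)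
      also have "real (Suc i) / real (Suc n) - real i / real (Suc n) = 1 / real (Suc n)"
        by (simp add: diff_divide_distrib[symmetric])
      finally show ?thesis by simp
    qed
    \<comment> \<open>In the layer of height \<open>Suc k\<close> the values of \<open>\<pi>\<close>
      fill at most \<open>[0, Suc k]\<close>, which takes \<open>Suc n * Suc k\<close> slabs of
      width \<open>1 / Suc n\<close>. One more index is present for the value \<open>Suc k\<close>
      itself.\<close>
    define I where "I n = {..Suc n * Suc k}" for n
    define E where "E n = (\<Union>i\<in>I n. {\<omega> \<in> space M. 2 \<le> card (\<Phi> \<omega> \<inter> S n i)})" for n
    have "AE \<omega> in M. \<exists>n. \<omega> \<notin> E n"
    \<comment> \<open>There are at most \<open>2 * Suc n * ?k\<close> slabs, each holding two atoms
      with probability at most the square of \<open>?k / Suc n\<close>.\<close>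
    proof (rule AE_of_null_bound[where C="2 * ?k ^ 3"])
      fix n
      show "E n \<in> events"
        unfolding E_def I_def by (intro sets.finite_UN count_event S_obs) auto
      have "prob (E n) \<le> (\<Sum>i\<in>I n. prob {\<omega> \<in> space M. 2 \<le> card (\<Phi> \<omega> \<inter> S n i)})"
        unfolding E_def by (rule finite_measure_subadditive_finite) (auto simp: I_def intro!: count_event S_obs)
      also have "\<dots> \<le> (\<Sum>i\<in>I n. (?k / real (Suc n))\<^sup>2)"
        by (intro sum_mono order_trans[OF prob_two_atoms[OF S_obs]] power_mono S_le) auto
      also have "\<dots> = real (Suc (Suc n * Suc k)) * (?k / real (Suc n))\<^sup>2"
        by (simp add: I_def)
      also have "\<dots> \<le> (2 * real (Suc n) * ?k) * (?k / real (Suc n))\<^sup>2"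
      proof (rule mult_right_mono)
        have "1 \<le> Suc n * Suc k" by simp
        then have "Suc (Suc n * Suc k) \<le> 2 * (Suc n * Suc k)" by linarith
        then have "real (Suc (Suc n * Suc k)) \<le> real (2 * (Suc n * Suc k))"
          by (simp only: of_nat_le_iff)
        then show "real (Suc (Suc n * Suc k)) \<le> 2 * real (Suc n) * ?k"
          by (simp only: of_nat_mult of_nat_numeral mult.assoc)
      qed simp
      also have "\<dots> = 2 * ?k ^ 3 / real (Suc n)"
        by (simp add: power2_eq_square power3_eq_cube divide_simps)
      finally show "prob (E n) \<le> 2 * ?k ^ 3 / real (Suc n)" .
    qed
    then show ?thesis
    proof (rule AE_mp, intro AE_I2 impI inj_onI)
      fix \<omega> p p'
      assume \<omega>: "\<omega> \<in> space M" and "\<exists>n. \<omega> \<notin> E n"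
        and p: "p \<in> \<Phi> \<omega> \<inter> layer ?k" and p': "p' \<in> \<Phi> \<omega> \<inter> layer ?k" and eq: "\<pi> p = \<pi> p'"
      then obtain n where n: "\<omega> \<notin> E n" by auto
      define i where "i = nat \<lfloor>real (Suc n) * \<pi> p\<rfloor>"
      have r: "0 \<le> \<pi> p" "\<pi> p \<le> ?k" using range[of ?k p] p by auto
      then have i: "real i \<le> real (Suc n) * \<pi> p" "real (Suc n) * \<pi> p < real i + 1"
        unfolding i_def by (auto simp: of_nat_nat)
      have "real i \<le> real (Suc n) * ?k"
        using i(1) r(2) by (meson mult_left_mono of_nat_0_le_iff order_trans)
      then have "real i \<le> real (Suc n * Suc k)" by (simp only: of_nat_mult)
      then have "i \<in> I n" unfolding I_def atMost_iff of_nat_le_iff .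
      moreover have "p \<in> S n i" "p' \<in> S n i"
        using i p p' eq unfolding S_def by (auto simp: field_simps)
      ultimately have "card (\<Phi> \<omega> \<inter> S n i) \<le> 1"
        using n \<omega> unfolding E_def by fastforce
      moreover have "finite (\<Phi> \<omega> \<inter> S n i)" by (rule finite_atoms[OF S_obs \<omega>])
      ultimately show "p = p'"
        using p p' \<open>p \<in> S n i\<close> \<open>p' \<in> S n i\<close> by (auto simp: card_le_Suc0_iff_eq)
    qed
  qed
  then have "AE \<omega> in M. \<forall>k::nat. inj_on \<pi> (\<Phi> \<omega> \<inter> layer (Suc k))" by (simp add: AE_all_countable)
  then show ?thesis
  proof (rule AE_mp, intro AE_I2 impI inj_onI)
    fix \<omega> p p'
    assume *: "\<omega> \<in> space M" "\<forall>k::nat. inj_on \<pi> (\<Phi> \<omega> \<inter> layer (Suc k))" "p \<in> \<Phi> \<omega>" "p' \<in> \<Phi> \<omega>" "\<pi> p = \<pi> p'"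
    obtain k :: nat where k: "max (snd p) (snd p') \<le> k" using real_arch_simple by blast
    then have "p \<in> layer (Suc k)" "p' \<in> layer (Suc k)"
      using strip_subset_layer[of p "Suc k"] strip_subset_layer[of p' "Suc k"]
        atoms_in_strip[OF *(1)] *(3,4) by auto
    then show "p = p'" using * by (meson IntI inj_onD)
  qed
qed

lemma AE_inj_time: "AE \<omega> in M. inj_on fst (\<Phi> \<omega>)"
proof (rule AE_no_ties)
  show "measure lborel (layer k \<inter> fst -` {a..b}) \<le> (b - a) * k" if "1 \<le> k" "a \<le> b" for k a b
  proof -
    have "measure lborel (layer k \<inter> fst -` {a..b}) \<le> measure lborel ({a..b} \<times> {0..k})"
      using that by (intro measure_mono_fmeasurable fmeasurable_rectangle)
        (auto simp: layer_def intro!: borel_closed closed_Int closed_Times closed_vimage_fst)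
    also have "\<dots> = (b - a) * k" using that by (simp add: measure_def emeasure_rectangle)
    finally show ?thesis .
  qed
qed (auto simp: layer_def intro!: borel_measurable_continuous_onI continuous_intros)

lemma AE_inj_score: "AE \<omega> in M. inj_on snd (\<Phi> \<omega>)"
proof (rule AE_no_ties)
  show "measure lborel (layer k \<inter> snd -` {a..b}) \<le> (b - a) * k" if "1 \<le> k" "a \<le> b" for k a b
  proof -
    have "measure lborel (layer k \<inter> snd -` {a..b}) \<le> measure lborel ({0..1::real} \<times> {a..b})"
      using that by (intro measure_mono_fmeasurable fmeasurable_rectangle)
        (auto simp: layer_def intro!: borel_closed closed_Int closed_Times closed_vimage_snd)
    also have "\<dots> = (b - a) * 1" using that by (simp add: measure_def emeasure_rectangle)
    also have "\<dots> \<le> (b - a) * k" using that by (intro mult_left_mono) auto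
    finally show ?thesis .
  qed
qed (auto simp: layer_def intro!: borel_measurable_continuous_onI continuous_intros)

text \<open>Time 1 is excluded because it is the default value of the stopping time and could feign
  a success; score 0 is excluded because the cells used later are open at the bottom.\<close>

lemma AE_interior: "AE \<omega> in M. \<forall>p\<in>\<Phi> \<omega>. fst p < 1 \<and> 0 < snd p"
proof -
  have "AE \<omega> in M. \<Phi> \<omega> \<inter> ({1} \<times> {0..}) = {}"
  proof (rule AE_no_atoms)
    show "measure lborel ({1} \<times> {0..} \<inter> layer k) = 0" for k :: nat
    proof -
      have "({1} \<times> {0..} \<inter> layer k) = {1..1} \<times> {0..real k}" by (auto simp: layer_def)
      then show ?thesis by (simp only: measure_def) (subst emeasure_rectangle, auto)
    qed
  qed (auto simp: strip_def)
  moreover have "AE \<omega> in M. \<Phi> \<omega> \<inter> ({0..1} \<times> {0}) = {}"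
  proof (rule AE_no_atoms)
    show "measure lborel ({0..1} \<times> {0} \<inter> layer k) = 0" for k :: nat
    proof -
      have "({0..1} \<times> {0} \<inter> layer k) = {0..1} \<times> {0..0}" by (auto simp: layer_def)
      then show ?thesis by (simp only: measure_def) (subst emeasure_rectangle, auto)
    qed
  qed (auto simp: strip_def)
  moreover have "AE \<omega> in M. \<Phi> \<omega> \<subseteq> strip" using atoms_in_strip by (rule AE_I2)
  ultimately show ?thesis
  proof eventually_elim
    case (elim \<omega>)
    show ?case
    proof
      fix p assume p: "p \<in> \<Phi> \<omega>"
      with elim(3) have "p \<in> strip" by auto
      with elim(1,2) p show "fst p < 1 \<and> 0 < snd p"
        by (cases p) (auto simp: strip_def disjoint_iff less_le)
    qed
  qed
qed

end

section \<open>Best atom and stopping time of a fixed configuration\<close>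

definition has_best :: "(real \<times> real) set \<Rightarrow> bool" where
  "has_best A \<longleftrightarrow> (\<exists>!p. is_arg_min snd (\<lambda>p. p \<in> A) p)"

lemma is_arg_min_alt:
  fixes p :: "real \<times> real"
  shows "is_arg_min snd (\<lambda>p. p \<in> A) p \<longleftrightarrow> p \<in> A \<and> (\<forall>p'\<in>A. snd p \<le> snd p')"
  by (auto simp: is_arg_min_def not_less)

lemma best_atomI:
  assumes "p \<in> A" "\<And>p'. p' \<in> A \<Longrightarrow> p' \<noteq> p \<Longrightarrow> snd p < snd p'"
  shows "has_best A" "best_atom A = p"
proof -
  have *: "is_arg_min snd (\<lambda>p. p \<in> A) q \<longleftrightarrow> q = p" for q
    unfolding is_arg_min_alt using assms by (metis less_eq_real_def linorder_not_le)
  show "has_best A" unfolding has_best_def * by simp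
  show "best_atom A = p" unfolding best_atom_def * by simp
qed

lemma has_bestD:
  assumes "has_best A"
  shows "best_atom A \<in> A" "\<And>p'. p' \<in> A \<Longrightarrow> p' \<noteq> best_atom A \<Longrightarrow> snd (best_atom A) < snd p'"
proof -
  obtain p where p: "is_arg_min snd (\<lambda>p. p \<in> A) p" "\<And>q. is_arg_min snd (\<lambda>p. p \<in> A) q \<Longrightarrow> q = p"
    using assms unfolding has_best_def by blast
  have b: "best_atom A = p"
    using assms p unfolding best_atom_def has_best_def by (metis (no_types, lifting) theI')
  show "best_atom A \<in> A" using p(1) by (simp add: b is_arg_min_alt)
  fix p' assume p': "p' \<in> A" "p' \<noteq> best_atom A"
  show "snd (best_atom A) < snd p'"
  proof (rule ccontr)
    assume "\<not> ?thesis"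
    then have "is_arg_min snd (\<lambda>p. p \<in> A) p'"
      using p(1) p'(1) unfolding b is_arg_min_alt by (meson linorder_not_le order_trans)
    with p(2) p'(2) b show False by simp
  qed
qed

definition locally_finite_in_strip :: "(real \<times> real) set \<Rightarrow> bool" where
  "locally_finite_in_strip A \<longleftrightarrow> A \<subseteq> strip \<and> (\<forall>B. bounded B \<longrightarrow> finite (A \<inter> B))"

lemma finite_below:
  assumes "locally_finite_in_strip A"
  shows "finite {p \<in> A. snd p \<le> k}"
proof -
  have "finite (A \<inter> ({0..1} \<times> {0..k}))"
    using assms by (auto simp: locally_finite_in_strip_def bounded_Times)
  moreover have "{p \<in> A. snd p \<le> k} \<subseteq> A \<inter> ({0..1} \<times> {0..k})"
    using assms by (auto simp: locally_finite_in_strip_def strip_def)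
  ultimately show ?thesis by (rule rev_finite_subset)
qed

lemma has_best_if_inj:
  assumes A: "locally_finite_in_strip A" "A \<noteq> {}" "inj_on snd A"
  shows "has_best A"
proof -
  obtain p0 where p0: "p0 \<in> A" using A by auto
  let ?B = "{p \<in> A. snd p \<le> snd p0}"
  have "finite ?B" by (rule finite_below[OF A(1)])
  moreover have "?B \<noteq> {}" using p0 by blast
  ultimately have B: "finite ?B" "?B \<noteq> {}" by auto
  define p where "p = arg_min_on snd ?B"
  have p: "p \<in> ?B" unfolding p_def by (rule arg_min_if_finite(1)[OF B])
  show ?thesis
  proof (rule best_atomI)
    show "p \<in> A" using p by simp
    fix p' assume p': "p' \<in> A" "p' \<noteq> p"
    have "\<not> (\<exists>p'\<in>?B. snd p' < snd p)"
      unfolding p_def by (rule arg_min_if_finite(2)[OF B])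
    then have "\<not> snd p' < snd p" using p p' by fastforce
    moreover have "snd p' \<noteq> snd p" using A(3) p p' by (auto dest: inj_onD)
    ultimately show "snd p < snd p'" by simp
  qed
qed

text \<open>Finitely many atoms have a score within 1 of the best, so the best score is followed by
  a gap. A rational level in the gap isolates the best atom, and rational levels allow countable
  unions of events.\<close>

lemma has_best_rational:
  assumes A: "locally_finite_in_strip A" and "has_best A"
  obtains q :: rat where "{p \<in> A. snd p \<le> of_rat q} = {best_atom A}"
proof -
  let ?p = "best_atom A"
  note b = has_bestD[OF assms(2)]
  let ?B = "{p \<in> A. snd p \<le> snd ?p + 1} - {?p}"
  have fin: "finite ?B" using finite_below[OF A] by simp
  define m where "m = Min (insert (snd ?p + 1) (snd ` ?B))"
  have "snd ?p < m"
    unfolding m_def by (subst Min_gr_iff) (use fin b in auto)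
  then obtain q where q: "snd ?p < of_rat q" "of_rat q < m" using of_rat_dense by blast
  have "p = ?p" if "p \<in> A" "snd p \<le> of_rat q" for p
  proof (rule ccontr)
    assume "p \<noteq> ?p"
    have "m \<le> snd ?p + 1" unfolding m_def by (rule Min_le) (use fin in auto)
    then have "p \<in> ?B" using that q \<open>p \<noteq> ?p\<close> by auto
    then have "m \<le> snd p" unfolding m_def by (intro Min_le) (use fin in auto)
    with that q show False by simp
  qed
  then have "{p \<in> A. snd p \<le> of_rat q} = {?p}" using b(1) less_imp_le[OF q(1)] by blast
  then show ?thesis by (rule that)
qed

lemma has_best_singleton:
  assumes "{p \<in> A. snd p \<le> k} = {p0}"
  shows "has_best A" "best_atom A = p0"
proof -
  have p0: "p0 \<in> A" "snd p0 \<le> k" using assms by auto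
  have "snd p0 < snd p'" if "p' \<in> A" "p' \<noteq> p0" for p'
  proof (rule ccontr)
    assume "\<not> ?thesis"
    then have "p' \<in> {p \<in> A. snd p \<le> k}" using p0 that by simp
    with assms that show False by blast
  qed
  with p0(1) show "has_best A" "best_atom A = p0" by (auto intro: best_atomI)
qed

lemma memoryless_time_empty: "A \<inter> subgraph f = {} \<Longrightarrow> memoryless_time f A = 1"
  by (simp add: memoryless_time_def memoryless_point_def)

lemma memoryless_time_eq:
  assumes "p \<in> A \<inter> subgraph f" "\<And>p'. p' \<in> A \<inter> subgraph f \<Longrightarrow> fst p \<le> fst p'"
  shows "memoryless_time f A = fst p"
proof -
  define q where "q = arg_min fst (\<lambda>p. p \<in> A \<inter> subgraph f)"
  have "q \<in> A \<inter> subgraph f \<and> (\<forall>p'. p' \<in> A \<inter> subgraph f \<longrightarrow> \<not> fst p' < fst q)"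
    unfolding q_def by (rule arg_minI[of "\<lambda>p. p \<in> A \<inter> subgraph f" p]) (use assms in \<open>auto simp: not_less\<close>)
  then have "fst q = fst p" using assms by (meson antisym linorder_not_le)
  then show ?thesis
    using assms(1) by (auto simp: memoryless_time_def memoryless_point_def q_def)
qed

text \<open>Only atoms of the subgraph no later than a given one compete, and monotonicity bounds
  their scores by the value of the curve at that time; hence they are finite in number.\<close>

lemma memoryless_attained:
  assumes f: "curve f" and A: "locally_finite_in_strip A" and ne: "A \<inter> subgraph f \<noteq> {}"
  shows "\<exists>p\<in>A \<inter> subgraph f. (\<forall>p'\<in>A \<inter> subgraph f. fst p \<le> fst p') \<and> memoryless_time f A = fst p"
proof -
  obtain p0 where p0: "p0 \<in> A \<inter> subgraph f" using ne by auto
  let ?B = "{p \<in> A \<inter> subgraph f. fst p \<le> fst p0}"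
  have "?B \<subseteq> {p \<in> A. snd p \<le> f (fst p0)}"
    using curve_mono[OF f] p0 by (fastforce simp: subgraph_def)
  then have "finite ?B" using finite_below[OF A] by (rule finite_subset)
  moreover have "?B \<noteq> {}" using p0 by blast
  ultimately have B: "finite ?B" "?B \<noteq> {}" by auto
  define p where "p = arg_min_on fst ?B"
  have p: "p \<in> ?B" unfolding p_def by (rule arg_min_if_finite(1)[OF B])
  have le: "fst p \<le> fst p'" if "p' \<in> A \<inter> subgraph f" for p'
  proof (rule ccontr)
    assume "\<not> ?thesis"
    then have "fst p' < fst p" by simp
    moreover from this have "p' \<in> ?B" using that p by auto
    moreover have "\<not> (\<exists>p'\<in>?B. fst p' < fst p)"
      unfolding p_def by (rule arg_min_if_finite(2)[OF B])
    ultimately show False by blast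
  qed
  have "memoryless_time f A = fst p" by (rule memoryless_time_eq) (use p le in auto)
  with p le show ?thesis by blast
qed

lemma memoryless_time_le:
  assumes "curve f" "locally_finite_in_strip A" "p \<in> A \<inter> subgraph f"
  shows "memoryless_time f A \<le> fst p"
proof -
  have ne: "A \<inter> subgraph f \<noteq> {}" using assms(3) by blast
  from memoryless_attained[OF assms(1,2) ne] assms(3) show ?thesis by fastforce
qed

lemma memoryless_time_bounds:
  assumes "curve f" "locally_finite_in_strip A"
  shows "0 \<le> memoryless_time f A" "memoryless_time f A \<le> 1"
proof -
  have "0 \<le> memoryless_time f A \<and> memoryless_time f A \<le> 1"
  proof (cases "A \<inter> subgraph f = {}")
    case False
    then obtain p where "p \<in> A \<inter> subgraph f" "memoryless_time f A = fst p"
      using memoryless_attained[OF assms] by blast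
    then show ?thesis by (auto simp: subgraph_def)
  qed (simp add: memoryless_time_empty)
  then show "0 \<le> memoryless_time f A" "memoryless_time f A \<le> 1" by auto
qed

text \<open>Turns the tail of the stopping time into a void event. For \<open>t < 1\<close> the
  default value 1 falls on the correct side.\<close>

lemma memoryless_time_greater_iff:
  assumes f: "curve f" and A: "locally_finite_in_strip A" and t: "t < 1"
  shows "t < memoryless_time f A \<longleftrightarrow> A \<inter> {p \<in> subgraph f. fst p \<le> t} = {}"
proof (cases "A \<inter> subgraph f = {}")
  case True
  then show ?thesis using t by (auto simp: memoryless_time_empty)
next
  case False
  then obtain p where p: "p \<in> A \<inter> subgraph f"
    and le: "\<forall>p'\<in>A \<inter> subgraph f. fst p \<le> fst p'"
    and \<tau>: "memoryless_time f A = fst p"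
    using memoryless_attained[OF f A] by blast
  show ?thesis
  proof
    assume t': "t < memoryless_time f A"
    have "\<not> fst q \<le> t" if "q \<in> A" "q \<in> subgraph f" for q
      using bspec[OF le, of q] that t' \<tau> by simp
    then show "A \<inter> {p \<in> subgraph f. fst p \<le> t} = {}" by blast
  next
    assume "A \<inter> {p \<in> subgraph f. fst p \<le> t} = {}"
    then have "\<not> fst p \<le> t" using p by blast
    then show "t < memoryless_time f A" using \<tau> by simp
  qed
qed

text \<open>The atoms that may not occur if an atom at \<open>(t, x)\<close> of the subgraph is to be selected and best.\<close>

definition exclusion_region :: "(real \<Rightarrow> real) \<Rightarrow> real \<Rightarrow> real \<Rightarrow> (real \<times> real) set" where
  "exclusion_region f t x = {(s, y). 0 \<le> s \<and> s \<le> 1 \<and> 0 \<le> y \<and> (y \<le> x \<or> s < t \<and> y \<le> f s)}"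

lemma measure_hypograph:
  fixes q :: "real \<Rightarrow> real"
  assumes q [measurable]: "q \<in> borel_measurable borel" and T [measurable]: "T \<in> sets borel"
    and T': "T \<subseteq> {0..1}" and bound: "\<And>s. s \<in> T \<Longrightarrow> 0 \<le> q s \<and> q s \<le> K"
  shows "{p. fst p \<in> T \<and> 0 \<le> snd p \<and> snd p \<le> q (fst p)} \<in> sets borel"
    and "bounded {p. fst p \<in> T \<and> 0 \<le> snd p \<and> snd p \<le> q (fst p)}"
    and "measure lborel {p. fst p \<in> T \<and> 0 \<le> snd p \<and> snd p \<le> q (fst p)} = (LINT s:T|lborel. q s)"
proof -
  let ?R = "{p. fst p \<in> T \<and> 0 \<le> snd p \<and> snd p \<le> q (fst p)}"
  have "Measurable.pred (borel \<Otimes>\<^sub>M borel) (\<lambda>p. fst p \<in> T \<and> 0 \<le> snd p \<and> snd p \<le> q (fst p))"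
    by measurable
  then have "{p \<in> space (borel \<Otimes>\<^sub>M borel). fst p \<in> T \<and> 0 \<le> snd p \<and> snd p \<le> q (fst p)} \<in> sets (borel \<Otimes>\<^sub>M borel)"
    unfolding pred_def .
  then show m: "?R \<in> sets borel" by (simp only: borel_prod space_borel UNIV_I simp_thms)
  have "?R \<subseteq> {0..1} \<times> {0..K}" using T' bound by fastforce
  then show b: "bounded ?R" by (rule bounded_subset[rotated]) (intro bounded_Times, auto)
  have int: "integrable (lborel \<Otimes>\<^sub>M lborel) (indicator ?R :: real \<times> real \<Rightarrow> real)"
    unfolding lborel_prod by (rule integrable_real_indicator) (use m b emeasure_bounded_finite in auto)
  have "measure lborel ?R = (LINT p|lborel. indicator ?R p)"
    using m by simp
  also have "\<dots> = (LINT s|lborel. LINT y|lborel. indicator ?R (s, y))"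
    using lborel_pair.integral_fst'[OF int] by (simp add: lborel_prod)
  also have "\<dots> = (LINT s:T|lborel. q s)"
    unfolding set_lebesgue_integral_def
  proof (rule Bochner_Integration.integral_cong)
    fix s
    have "indicator ?R (s, y) = indicator T s * (indicator {0..q s} y :: real)" for y
      by (auto simp: indicator_def)
    then show "(LINT y|lborel. indicator ?R (s, y)) = indicator T s *\<^sub>R q s"
      using bound[of s] by (cases "s \<in> T") auto
  qed simp
  finally show "measure lborel ?R = (LINT s:T|lborel. q s)" .
qed

lemma measure_exclusion_region:
  assumes f: "curve f" and t: "t < 1" and x: "0 \<le> x"
  shows "exclusion_region f t x \<in> sets borel" "bounded (exclusion_region f t x)"
    and "measure lborel (exclusion_region f t x) = expo f t x"
proof -
  have [measurable]: "f \<in> borel_measurable borel" using f by measurable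
  \<comment> \<open>The upper boundary of the region: the maximum of \<open>x\<close> and
    \<open>f s\<close> before \<open>t\<close>, and \<open>x\<close> from then on.\<close>
  define q where "q s = x + indicator {0..<t} s * max (f s - x) 0" for s
  have eq: "exclusion_region f t x = {p. fst p \<in> {0..1} \<and> 0 \<le> snd p \<and> snd p \<le> q (fst p)}"
    using t by (auto simp: exclusion_region_def q_def indicator_def)
  have bound: "0 \<le> q s \<and> q s \<le> x + f t" for s
    using x curve_nonneg[OF f] curve_mono[OF f _ t, of s] by (auto simp: q_def indicator_def)
  have qm: "q \<in> borel_measurable borel" unfolding q_def[abs_def] by measurable
  note h = measure_hypograph[OF qm, of "{0..1}" "x + f t"]
  show "exclusion_region f t x \<in> sets borel" "bounded (exclusion_region f t x)"
    unfolding eq using h(1,2) bound by auto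
  have "measure lborel (exclusion_region f t x) = (LINT s:{0..1}|lborel. q s)"
    unfolding eq using h(3) bound by auto
  also have "\<dots> = (LINT s:{0..1::real}|lborel. x) + (LINT s:{0..1}|lborel. indicator {0..<t} s * max (f s - x) 0)"
    unfolding q_def
  proof -
    have xi: "set_integrable lborel {0..1::real} (\<lambda>s. x)"
      by (rule set_integrable_bounded_real[where B=x]) (use x in auto)
    have "\<bar>indicator {0..<t} s * max (f s - x) 0\<bar> \<le> f t" for s
    proof (cases "s \<in> {0..<t}")
      case True
      with curve_mono[OF f _ t, of s] x curve_nonneg[OF f, of t] show ?thesis by simp
    qed (use curve_nonneg[OF f, of t] in simp)
    then have "set_integrable lborel {0..1} (\<lambda>s. indicator {0..<t} s * max (f s - x) 0)"
      by (intro set_integrable_bounded_real[where B="f t"]) auto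
    with xi show "(LINT s:{0..1}|lborel. x + indicator {0..<t} s * max (f s - x) 0)
      = (LINT s:{0..1::real}|lborel. x) + (LINT s:{0..1}|lborel. indicator {0..<t} s * max (f s - x) 0)"
      by (rule set_integral_add(2))
  qed
  also have "(LINT s:{0..1}|lborel. indicator {0..<t} s * max (f s - x) 0) = (LINT s:{0..<t}|lborel. max (f s - x) 0)"
    unfolding set_lebesgue_integral_def
    by (rule Bochner_Integration.integral_cong) (use t in \<open>auto simp: indicator_def\<close>)
  finally show "measure lborel (exclusion_region f t x) = expo f t x"
    by (simp add: expo_def set_integral_const)
qed

section \<open>Law of the stopping time\<close>

context unit_poisson_process
begin

lemma locally_finite_atoms: "\<omega> \<in> space M \<Longrightarrow> locally_finite_in_strip (\<Phi> \<omega>)"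
  using atoms_in_strip locally_finite by (auto simp: locally_finite_in_strip_def)

lemma stopping_region:
  assumes f: "curve f" and t: "t < 1"
  shows "observable {p \<in> subgraph f. fst p \<le> t}"
    and "measure lborel {p \<in> subgraph f. fst p \<le> t} = expo f t 0"
proof -
  have eq: "{p \<in> subgraph f. fst p \<le> t} = {p. fst p \<in> {0..t} \<and> 0 \<le> snd p \<and> snd p \<le> f (fst p)}"
    using t by (auto simp: subgraph_def)
  have "0 \<le> f s \<and> f s \<le> f t" if "s \<in> {0..t}" for s
    using curve_nonneg[OF f] curve_mono[OF f, of s t] that t by auto
  note h = measure_hypograph[OF curve_measurable[OF f], of "{0..t}" "f t", OF _ _ this]
  show "observable {p \<in> subgraph f. fst p \<le> t}"
    unfolding eq observable_def using h(1,2) t by (auto simp: strip_def)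
  show "measure lborel {p \<in> subgraph f. fst p \<le> t} = expo f t 0"
    unfolding eq using h(3) t by (simp add: curve_integral_eq_expo[OF f, symmetric] curve_integral_def)
qed

lemma memoryless_time_measurable:
  assumes f: "curve f"
  shows "(\<lambda>\<omega>. memoryless_time f (\<Phi> \<omega>)) \<in> borel_measurable M"
proof (rule borel_measurable_iff_greater[THEN iffD2], rule allI)
  fix a :: real
  show "{\<omega> \<in> space M. a < memoryless_time f (\<Phi> \<omega>)} \<in> events"
  proof (cases "a < 1")
    case True
    then have "{\<omega> \<in> space M. a < memoryless_time f (\<Phi> \<omega>)}
      = {\<omega> \<in> space M. \<Phi> \<omega> \<inter> {p \<in> subgraph f. fst p \<le> a} = {}}"
      using memoryless_time_greater_iff[OF f locally_finite_atoms] by (intro Collect_cong) auto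
    then show ?thesis using void_event[OF stopping_region(1)[OF f True]] by simp
  next
    case False
    then have "{\<omega> \<in> space M. a < memoryless_time f (\<Phi> \<omega>)} = {}"
      using memoryless_time_bounds(2)[OF f locally_finite_atoms]
      by (force simp: not_less)
    then show ?thesis by (simp only: sets.empty_sets)
  qed
qed

lemma prob_memoryless_time_greater:
  assumes f: "curve f" and t: "t < 1"
  shows "prob {\<omega> \<in> space M. t < memoryless_time f (\<Phi> \<omega>)} = exp (- expo f t 0)"
proof -
  have "{\<omega> \<in> space M. t < memoryless_time f (\<Phi> \<omega>)}
    = {\<omega> \<in> space M. \<Phi> \<omega> \<inter> {p \<in> subgraph f. fst p \<le> t} = {}}"
    using memoryless_time_greater_iff[OF f locally_finite_atoms t] by (intro Collect_cong) auto
  then show ?thesis using prob_void[OF stopping_region(1)[OF f t]] by (simp add: stopping_region(2)[OF f t])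
qed

text \<open>The tail formula for a variable with values in \<open>[0,1]\<close>, by Fubini for the
  indicator of \<open>t < \<tau>\<close>.\<close>

lemma expectation_memoryless_time:
  assumes f: "curve f"
  shows "expectation (\<lambda>\<omega>. memoryless_time f (\<Phi> \<omega>)) = mean_time f"
proof -
  have P: "pair_sigma_finite M (lborel :: real measure)" ..
  note [measurable] = memoryless_time_measurable[OF f]
  let ?\<tau> = "\<lambda>\<omega>. memoryless_time f (\<Phi> \<omega>)"
  define k where "k \<omega> t = (if 0 \<le> t \<and> t < 1 \<and> t < ?\<tau> \<omega> then 1 else 0 :: real)" for \<omega> t
  have k_eq: "k \<omega> t = indicator {0..<?\<tau> \<omega>} t" if "\<omega> \<in> space M" for \<omega> t
    using memoryless_time_bounds(2)[OF f locally_finite_atoms[OF that]] by (auto simp: k_def)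
  have k_val: "(LINT t|lborel. k \<omega> t) = ?\<tau> \<omega>" if "\<omega> \<in> space M" for \<omega>
    using memoryless_time_bounds(1)[OF f locally_finite_atoms[OF that]] by (simp add: k_eq[OF that])
  have k_int: "integrable (M \<Otimes>\<^sub>M lborel) (\<lambda>(\<omega>, t). k \<omega> t)"
  proof (rule pair_sigma_finite.Fubini_integrable[OF P])
    show "(\<lambda>(\<omega>, t). k \<omega> t) \<in> borel_measurable (M \<Otimes>\<^sub>M lborel)"
      unfolding k_def by measurable
    have "integrable M ?\<tau>"
      by (rule integrable_const_bound[where B=1])
        (use memoryless_time_bounds[OF f locally_finite_atoms] in \<open>auto intro!: AE_I2\<close>)
    then show "integrable M (\<lambda>\<omega>. LINT t|lborel. norm (case (\<omega>, t) of (\<omega>, t) \<Rightarrow> k \<omega> t))"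
    proof (rule Bochner_Integration.integrable_cong[THEN iffD1, rotated 2])
      fix \<omega> assume \<omega>: "\<omega> \<in> space M"
      have "norm (k \<omega> t) = k \<omega> t" for t by (simp add: k_def)
      then show "?\<tau> \<omega> = (LINT t|lborel. norm (case (\<omega>, t) of (\<omega>, t) \<Rightarrow> k \<omega> t))"
        by (simp only: case_prod_conv k_val[OF \<omega>])
    qed simp
    show "AE \<omega> in M. integrable lborel (\<lambda>t. case (\<omega>, t) of (\<omega>, t) \<Rightarrow> k \<omega> t)"
      using memoryless_time_bounds(1)[OF f locally_finite_atoms]
      by (intro AE_I2) (simp add: k_eq)
  qed
  have "expectation ?\<tau> = (LINT \<omega>|M. LINT t|lborel. k \<omega> t)"
    by (rule Bochner_Integration.integral_cong) (auto simp: k_val)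
  also have "\<dots> = (LINT t|lborel. LINT \<omega>|M. k \<omega> t)"
    using pair_sigma_finite.Fubini_integral[OF P k_int] by simp
  also have "\<dots> = mean_time f"
    unfolding mean_time_def set_lebesgue_integral_def
  proof (rule Bochner_Integration.integral_cong)
    fix t :: real
    have "(LINT \<omega>|M. k \<omega> t) = (LINT \<omega>|M. indicator {0..<1} t * indicator {\<omega> \<in> space M. t < ?\<tau> \<omega>} \<omega>)"
      by (rule Bochner_Integration.integral_cong) (auto simp: k_def indicator_def)
    then show "(LINT \<omega>|M. k \<omega> t) = indicator {0..<1} t *\<^sub>R exp (- expo f t 0)"
      using prob_memoryless_time_greater[OF f, of t] by (cases "t \<in> {0..<1}") simp_all
  qed simp
  finally show ?thesis .
qed

section \<open>The success probability\<close>

text \<open>The position of an extremal atom is recast in terms of counts, whose measurability is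
  given: a rational layer holds one atom, and that atom lies in \<open>C\<close>.\<close>

lemma has_best_eq:
  assumes \<omega>: "\<omega> \<in> space M" and C: "C \<in> sets borel" "C \<subseteq> strip"
  shows "has_best (\<Phi> \<omega>) \<and> best_atom (\<Phi> \<omega>) \<in> C \<longleftrightarrow>
    (\<exists>q::rat. card (\<Phi> \<omega> \<inter> layer (of_rat q)) = 1 \<and> card (\<Phi> \<omega> \<inter> (C \<inter> layer (of_rat q))) = 1)"
    (is "?L = ?R")
proof
  have layer: "\<Phi> \<omega> \<inter> layer k = {p \<in> \<Phi> \<omega>. snd p \<le> k}" for k
    using atoms_in_strip[OF \<omega>] by (auto simp: layer_def strip_def)
  {
    assume L: ?L
    then have "has_best (\<Phi> \<omega>)" by simp
    from has_best_rational[OF locally_finite_atoms[OF \<omega>] this]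
    obtain q :: rat where q: "{p \<in> \<Phi> \<omega>. snd p \<le> of_rat q} = {best_atom (\<Phi> \<omega>)}" by blast
    then have q': "\<Phi> \<omega> \<inter> layer (of_rat q) = {best_atom (\<Phi> \<omega>)}" unfolding layer .
    moreover have "\<Phi> \<omega> \<inter> (C \<inter> layer (of_rat q)) = {best_atom (\<Phi> \<omega>)}"
      using q' L by blast
    ultimately show ?R by (intro exI[of _ q]) simp
  next
    assume ?R
    then obtain q :: rat where q: "card (\<Phi> \<omega> \<inter> layer (of_rat q)) = 1"
      "card (\<Phi> \<omega> \<inter> (C \<inter> layer (of_rat q))) = 1" by blast
    then obtain p where p: "\<Phi> \<omega> \<inter> layer (of_rat q) = {p}" by (auto simp: card_1_singleton_iff)
    have "\<Phi> \<omega> \<inter> (C \<inter> layer (of_rat q)) \<noteq> {}" using q(2) by force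
    then obtain p' where p': "p' \<in> \<Phi> \<omega>" "p' \<in> C" "p' \<in> layer (of_rat q)" by blast
    then have "p' \<in> {p}" unfolding p[symmetric] by simp
    with p' have "p \<in> C" by simp
    moreover from p have "{p \<in> \<Phi> \<omega>. snd p \<le> of_rat q} = {p}" unfolding layer .
    note has_best_singleton[OF this]
    ultimately show ?L by simp
  }
qed

lemma best_event:
  assumes C: "C \<in> sets borel" "C \<subseteq> strip"
  shows "{\<omega> \<in> space M. has_best (\<Phi> \<omega>) \<and> best_atom (\<Phi> \<omega>) \<in> C} \<in> events"
proof -
  have "{\<omega> \<in> space M. has_best (\<Phi> \<omega>) \<and> best_atom (\<Phi> \<omega>) \<in> C} =
    (\<Union>q::rat. {\<omega> \<in> space M. card (\<Phi> \<omega> \<inter> layer (of_rat q)) = 1} \<inter>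
      {\<omega> \<in> space M. card (\<Phi> \<omega> \<inter> (C \<inter> layer (of_rat q))) = 1})"
    using has_best_eq[OF _ C] by auto
  also have "\<dots> \<in> events"
  proof (intro sets.countable_UN'' sets.Int count_event layer_observable)
    show "observable (C \<inter> layer (of_rat q))" for q :: rat
      by (rule observable_subset[OF layer_observable]) (use C layer_observable in \<open>auto simp: observable_def\<close>)
  qed auto
  finally show ?thesis .
qed

lemma best_time_measurable: "(\<lambda>\<omega>. best_time (\<Phi> \<omega>)) \<in> borel_measurable M"
proof (rule borel_measurable_iff_le[THEN iffD2], rule allI)
  fix a :: real
  let ?C = "strip \<inter> {p. fst p \<le> a}"
  have strip: "strip \<in> sets borel"
    unfolding strip_def by (rule rectangle_measurable) auto
  have "closed {p::real \<times> real. fst p \<le> a}"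
    by (intro closed_Collect_le continuous_intros)
  then have C: "?C \<in> sets borel" using strip by auto
  let ?U = "{\<omega> \<in> space M. has_best (\<Phi> \<omega>) \<and> best_atom (\<Phi> \<omega>) \<in> strip}"
  have in_strip: "has_best (\<Phi> \<omega>) \<Longrightarrow> best_atom (\<Phi> \<omega>) \<in> strip" if "\<omega> \<in> space M" for \<omega>
    using has_bestD(1) atoms_in_strip[OF that] by blast
  have undef: "\<not> has_best (\<Phi> \<omega>) \<Longrightarrow> best_time (\<Phi> \<omega>) = fst (undefined :: real \<times> real)" for \<omega>
    unfolding best_time_def best_atom_def has_best_def by presburger
  \<comment> \<open>Without a unique best atom the time is a fixed constant, so this event belongs
    to the sublevel set either entirely or not at all.\<close>
  have iff: "best_time (\<Phi> \<omega>) \<le> a \<longleftrightarrow> has_best (\<Phi> \<omega>) \<and> best_atom (\<Phi> \<omega>) \<in> ?C \<or>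
    fst (undefined :: real \<times> real) \<le> a \<and> \<not> (has_best (\<Phi> \<omega>) \<and> best_atom (\<Phi> \<omega>) \<in> strip)"
    if "\<omega> \<in> space M" for \<omega>
  proof (cases "has_best (\<Phi> \<omega>)")
    case True
    then show ?thesis using in_strip[OF that True] by (simp add: best_time_def)
  next
    case False
    then show ?thesis by (simp add: undef)
  qed
  have "{\<omega> \<in> space M. best_time (\<Phi> \<omega>) \<le> a} =
    {\<omega> \<in> space M. has_best (\<Phi> \<omega>) \<and> best_atom (\<Phi> \<omega>) \<in> ?C} \<union>
    (if fst (undefined :: real \<times> real) \<le> a then space M - ?U else {})"
    by (auto simp: iff)
  also have "\<dots> \<in> events"
    using best_event[OF C] best_event[OF strip] by auto
  finally show "{\<omega> \<in> space M. best_time (\<Phi> \<omega>) \<le> a} \<in> events" .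
qed

section \<open>Winning with the best atom in a prescribed set\<close>

definition win_event :: "(real \<Rightarrow> real) \<Rightarrow> (real \<times> real) set \<Rightarrow> 'w set" where
  "win_event f C = {\<omega> \<in> space M. has_best (\<Phi> \<omega>) \<and> best_atom (\<Phi> \<omega>) \<in> C \<and>
    memoryless_time f (\<Phi> \<omega>) = best_time (\<Phi> \<omega>)}"

lemma success_event:
  assumes "curve f"
  shows "{\<omega> \<in> space M. memoryless_time f (\<Phi> \<omega>) = best_time (\<Phi> \<omega>)} \<in> events"
  using memoryless_time_measurable[OF assms] best_time_measurable by measurable

lemma win_event_event:
  assumes "curve f" "C \<in> sets borel" "C \<subseteq> strip"
  shows "win_event f C \<in> events"
proof -
  have "win_event f C = {\<omega> \<in> space M. has_best (\<Phi> \<omega>) \<and> best_atom (\<Phi> \<omega>) \<in> C} \<inter>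
    {\<omega> \<in> space M. memoryless_time f (\<Phi> \<omega>) = best_time (\<Phi> \<omega>)}"
    by (auto simp: win_event_def)
  then show ?thesis using best_event[OF assms(2,3)] success_event[OF assms(1)] by simp
qed

lemma exclusion_observable:
  assumes "curve f" "t < 1" "0 \<le> x"
  shows "observable (exclusion_region f t x)"
  using measure_exclusion_region(1,2)[OF assms] by (auto simp: observable_def exclusion_region_def strip_def)

text \<open>One atom in \<open>C\<close> and none in the rest of the exclusion region at the upper
  right corner \<open>(b, d)\<close> forces a win, wherever in \<open>C\<close> the atom lies. The
  areas of \<open>C\<close> and of the rest add up to the exponent at that corner.\<close>

lemma win_event_lower:
  assumes f: "curve f" and C: "C \<in> sets borel" "C \<subseteq> subgraph f" "C \<subseteq> {..<b} \<times> {..d}"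
    and b: "b < 1" "0 \<le> d"
  shows "measure lborel C * exp (- expo f b d) \<le> prob (win_event f C)"
proof -
  let ?R = "exclusion_region f b d"
  note R = exclusion_observable[OF f b]
  have CR: "C \<subseteq> ?R" using C b by (fastforce simp: exclusion_region_def subgraph_def)
  have oC: "observable C" by (rule observable_subset[OF R C(1) CR])
  have oRC: "observable (?R - C)"
    using R C by (intro observable_subset[OF R]) (auto simp: observable_def)
  have "measure lborel ?R = measure lborel (C \<union> (?R - C))" using CR by (simp add: Un_absorb1)
  also have "\<dots> = measure lborel C + measure lborel (?R - C)"
    using emeasure_bounded_finite[of C] emeasure_bounded_finite[of "?R - C"] oC oRC
    by (intro measure_Union) (auto simp: observable_def)
  finally have m: "measure lborel C + measure lborel (?R - C) = expo f b d"
    using measure_exclusion_region(3)[OF f b] by simp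
  have sub: "{\<omega> \<in> space M. card (\<Phi> \<omega> \<inter> C) = 1 \<and> \<Phi> \<omega> \<inter> (?R - C) = {}} \<subseteq> win_event f C"
  proof
    fix \<omega> assume "\<omega> \<in> {\<omega> \<in> space M. card (\<Phi> \<omega> \<inter> C) = 1 \<and> \<Phi> \<omega> \<inter> (?R - C) = {}}"
    then have \<omega>: "\<omega> \<in> space M" and *: "card (\<Phi> \<omega> \<inter> C) = 1" "\<Phi> \<omega> \<inter> (?R - C) = {}" by auto
    from *(1) obtain p where "\<Phi> \<omega> \<inter> C = {p}" by (auto simp: card_1_singleton_iff)
    then have p: "\<Phi> \<omega> \<inter> ?R = {p}" "p \<in> C" "p \<in> \<Phi> \<omega>" using *(2) CR by blast+
    have strip: "\<Phi> \<omega> \<subseteq> strip" by (rule atoms_in_strip[OF \<omega>])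
    have pd: "snd p \<le> d" "fst p < b" "p \<in> subgraph f" using p C by auto
    have "p' = p" if "p' \<in> \<Phi> \<omega>" "snd p' \<le> d" for p'
    proof -
      have "p' \<in> ?R" using that strip by (auto simp: exclusion_region_def strip_def)
      then show ?thesis using that p by blast
    qed
    then have "{p' \<in> \<Phi> \<omega>. snd p' \<le> d} = {p}" using p(3) pd(1) by blast
    from has_best_singleton[OF this] have best: "has_best (\<Phi> \<omega>)" "best_atom (\<Phi> \<omega>) = p" .
    have "memoryless_time f (\<Phi> \<omega>) = fst p"
    proof (rule memoryless_time_eq)
      show "p \<in> \<Phi> \<omega> \<inter> subgraph f" using p pd by simp
      fix p' assume p': "p' \<in> \<Phi> \<omega> \<inter> subgraph f"
      show "fst p \<le> fst p'"
      proof (rule ccontr)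
        assume "\<not> ?thesis"
        then have "fst p' < b" "fst p' < fst p" using pd by auto
        then have "p' \<in> ?R" using p' by (auto simp: exclusion_region_def subgraph_def)
        then have "p' = p" using p' p by blast
        with \<open>fst p' < fst p\<close> show False by simp
      qed
    qed
    then show "\<omega> \<in> win_event f C" using \<omega> best p by (simp add: win_event_def best_time_def)
  qed
  have strip: "C \<subseteq> strip" using oC by (simp add: observable_def)
  have "measure lborel C * exp (- expo f b d)
    = prob {\<omega> \<in> space M. card (\<Phi> \<omega> \<inter> C) = 1 \<and> \<Phi> \<omega> \<inter> (?R - C) = {}}"
    using prob_one_void[OF oC oRC] m by auto
  also have "\<dots> \<le> prob (win_event f C)"
    by (rule finite_measure_mono[OF sub win_event_event[OF f C(1) strip]])
  finally show ?thesis .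
qed

text \<open>A win in \<open>C\<close> requires an atom in \<open>C\<close> and an empty exclusion
  region at the lower left corner \<open>(a, c)\<close>. As the scores in \<open>C\<close> lie
  strictly above \<open>c\<close>, the best atom itself stays outside that region.\<close>

lemma win_event_upper:
  assumes f: "curve f" and C: "C \<in> sets borel" "bounded C" "C \<subseteq> strip" "C \<subseteq> {a..} \<times> {c<..}"
    and a: "a < 1" "0 \<le> c"
  shows "prob (win_event f C) \<le> measure lborel C * exp (- expo f a c)"
proof -
  let ?R = "exclusion_region f a c"
  note R = exclusion_observable[OF f a]
  have oC: "observable C" using C by (simp add: observable_def)
  have sub: "win_event f C \<subseteq> {\<omega> \<in> space M. \<Phi> \<omega> \<inter> C \<noteq> {} \<and> \<Phi> \<omega> \<inter> ?R = {}}"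
  proof
    fix \<omega> assume "\<omega> \<in> win_event f C"
    then have \<omega>: "\<omega> \<in> space M" and b: "has_best (\<Phi> \<omega>)" and bC: "best_atom (\<Phi> \<omega>) \<in> C"
      and \<tau>: "memoryless_time f (\<Phi> \<omega>) = fst (best_atom (\<Phi> \<omega>))"
      by (auto simp: win_event_def best_time_def)
    let ?p = "best_atom (\<Phi> \<omega>)"
    have "?p \<in> {a..} \<times> {c<..}" using bC C(4) by blast
    then have p: "?p \<in> \<Phi> \<omega>" "a \<le> fst ?p" "c < snd ?p"
      using has_bestD(1)[OF b] by (auto simp: mem_Times_iff)
    have "q \<notin> ?R" if q: "q \<in> \<Phi> \<omega>" for q
    proof
      assume R: "q \<in> ?R"
      have "snd ?p \<le> snd q" using has_bestD(2)[OF b q] by (cases "q = ?p") auto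
      then have "fst q < a" "snd q \<le> f (fst q)" "0 \<le> fst q" "0 \<le> snd q"
        using R p(3) by (auto simp: exclusion_region_def)
      then have "q \<in> \<Phi> \<omega> \<inter> subgraph f" using q a by (auto simp: subgraph_def case_prod_unfold)
      then have "fst ?p \<le> fst q"
        using memoryless_time_le[OF f locally_finite_atoms[OF \<omega>]] \<tau> by simp
      with \<open>fst q < a\<close> p(2) show False by simp
    qed
    then show "\<omega> \<in> {\<omega> \<in> space M. \<Phi> \<omega> \<inter> C \<noteq> {} \<and> \<Phi> \<omega> \<inter> ?R = {}}"
      using \<omega> p(1) bC by blast
  qed
  have ev: "{\<omega> \<in> space M. \<Phi> \<omega> \<inter> C \<noteq> {} \<and> \<Phi> \<omega> \<inter> ?R = {}} \<in> events"
  proof -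
    have "{\<omega> \<in> space M. \<Phi> \<omega> \<inter> C \<noteq> {} \<and> \<Phi> \<omega> \<inter> ?R = {}}
      = {\<omega> \<in> space M. \<Phi> \<omega> \<inter> ?R = {}} - {\<omega> \<in> space M. \<Phi> \<omega> \<inter> C = {}}" by auto
    then show ?thesis using void_event[OF oC] void_event[OF R] by simp
  qed
  have "prob (win_event f C) \<le> prob {\<omega> \<in> space M. \<Phi> \<omega> \<inter> C \<noteq> {} \<and> \<Phi> \<omega> \<inter> ?R = {}}"
    by (rule finite_measure_mono[OF sub ev])
  also have "\<dots> \<le> measure lborel C * exp (- expo f a c)"
    using prob_hit_void[OF oC R] measure_exclusion_region(3)[OF f a] by simp
  finally show ?thesis .
qed

text \<open>Probability and integral lie between the same two bounds, given by the exponents at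
  opposite corners. The error is the area times the oscillation of the exponent, which is at most
  \<open>f b * (b - a)\<close> in time plus \<open>d - c\<close> in score.\<close>

lemma win_event_cell:
  assumes f: "curve f" and C: "C \<in> sets borel" "C \<subseteq> subgraph f" "C \<subseteq> {a..<b} \<times> {c<..d}"
    and ab: "0 \<le> a" "a \<le> b" "b < 1" and cd: "0 \<le> c" "c \<le> d"
  shows "\<bar>prob (win_event f C) - (LINT p|lborel. indicator C p * win_density f p)\<bar>
    \<le> ((b - a) * (d - c)) * (f b * (b - a) + (d - c))"
proof -
  let ?I = "LINT p|lborel. indicator C p * win_density f p"
  let ?m = "measure lborel C"
  have strip: "C \<subseteq> strip" using C(2) by (force simp: subgraph_def strip_def)
  have rect: "C \<subseteq> {a..b} \<times> {c..d}" using C(3) by force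
  have bdd: "bounded C" by (rule bounded_subset[OF _ rect]) (simp add: bounded_Times)
  have m_le: "?m \<le> (b - a) * (d - c)"
  proof -
    have "?m \<le> measure lborel ({a..b} \<times> {c..d})"
      by (rule measure_mono_fmeasurable[OF rect]) (use C ab cd in \<open>auto intro: fmeasurable_rectangle\<close>)
    then show ?thesis using ab cd by (simp add: measure_def emeasure_rectangle)
  qed
  have low: "?m * exp (- expo f b d) \<le> prob (win_event f C)"
    by (rule win_event_lower[OF f C(1,2)]) (use C(3) ab cd in auto)
  have up: "prob (win_event f C) \<le> ?m * exp (- expo f a c)"
    by (rule win_event_upper[OF f C(1) bdd strip]) (use C(3) ab cd in auto)
  have intC: "integrable lborel (\<lambda>p. indicator C p * k)" for k :: real
    using C(1) bdd emeasure_bounded_finite[OF bdd]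
    by (intro integrable_mult_left integrable_real_indicator) auto
  have intw: "integrable lborel (\<lambda>p. indicator C p * win_density f p)"
    by (rule integrable_real_mult_indicator[OF _ win_density_integrable[OF f],
        unfolded mult.commute[of "win_density f _"]]) (use C in auto)
  have valC: "(LINT p|lborel. indicator C p * k) = ?m * k" for k :: real
    using C(1) by simp
  have wb: "exp (- expo f b d) \<le> win_density f p \<and> win_density f p \<le> exp (- expo f a c)" if "p \<in> C" for p
  proof -
    obtain t x where p: "p = (t, x)" by (cases p)
    have tx: "a \<le> t" "t < b" "c < x" "x \<le> d" using C(3) that p by auto
    have "expo f a c \<le> expo f a x" by (rule expo_mono_score(1)[OF f]) (use tx ab in auto)
    also have "\<dots> \<le> expo f t x" by (rule expo_mono_time(1)[OF f]) (use tx ab cd in auto)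
    finally have 1: "expo f a c \<le> expo f t x" .
    have "expo f t x \<le> expo f t d" by (rule expo_mono_score(1)[OF f]) (use tx ab in auto)
    also have "\<dots> \<le> expo f b d" by (rule expo_mono_time(1)[OF f]) (use tx ab cd in auto)
    finally have 2: "expo f t x \<le> expo f b d" .
    have "(t, x) \<in> subgraph f" using C(2) that p by auto
    with 1 2 show ?thesis by (simp add: p win_density_def)
  qed
  have "?m * exp (- expo f b d) \<le> ?I"
    unfolding valC[symmetric] by (rule integral_mono[OF intC intw]) (use wb in \<open>auto simp: indicator_def\<close>)
  moreover have "?I \<le> ?m * exp (- expo f a c)"
    unfolding valC[symmetric] by (rule integral_mono[OF intw intC]) (use wb in \<open>auto simp: indicator_def\<close>)
  ultimately have "\<bar>prob (win_event f C) - ?I\<bar> \<le> ?m * (exp (- expo f a c) - exp (- expo f b d))"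
    using low up by (simp add: abs_le_iff algebra_simps)
  also have "\<dots> \<le> ((b - a) * (d - c)) * (f b * (b - a) + (d - c))"
  proof (rule mult_mono[OF m_le])
    let ?d = "expo f b d - expo f a c"
    have d1: "expo f b d - expo f a d \<le> f b * (b - a)"
      by (rule expo_mono_time(2)[OF f]) (use ab cd in auto)
    have d2: "expo f a d - expo f a c \<le> d - c"
      by (rule expo_mono_score(2)[OF f]) (use ab cd in auto)
    have "exp (- expo f a c) * (1 - ?d) \<le> exp (- expo f a c) * exp (- ?d)"
      using exp_ge_add_one_self[of "- ?d"] by (intro mult_left_mono) (linarith, simp)
    also have "\<dots> = exp (- expo f b d)" by (simp add: exp_add[symmetric])
    finally have "exp (- expo f a c) - exp (- expo f b d) \<le> exp (- expo f a c) * ?d"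
      by (simp add: algebra_simps)
    also have "\<dots> \<le> 1 * ?d"
    proof (rule mult_right_mono)
      show "exp (- expo f a c) \<le> 1" using expo_ge[of c f a] cd by simp
      have "expo f a c \<le> expo f a d" by (rule expo_mono_score(1)[OF f]) (use ab cd in auto)
      also have "\<dots> \<le> expo f b d" by (rule expo_mono_time(1)[OF f]) (use ab cd in auto)
      finally show "0 \<le> ?d" by simp
    qed
    finally show "exp (- expo f a c) - exp (- expo f b d) \<le> f b * (b - a) + (d - c)"
      using d1 d2 by simp
    have "expo f a c \<le> expo f a d" by (rule expo_mono_score(1)[OF f]) (use ab cd in auto)
    also have "\<dots> \<le> expo f b d" by (rule expo_mono_time(1)[OF f]) (use ab cd in auto)
    finally show "0 \<le> exp (- expo f a c) - exp (- expo f b d)" by simp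
    show "0 \<le> (b - a) * (d - c)" using ab cd by simp
  qed
  finally show ?thesis .
qed

text \<open>Up to time \<open>\<beta> < 1\<close> the curve is bounded, so a grid of
  \<open>Suc n * Suc n\<close> cells has errors of order n^-3 per cell and 1/n in total, while the
  difference to be estimated does not depend on \<open>n\<close>.\<close>

lemma win_event_truncated:
  assumes f: "curve f" and \<beta>: "0 < \<beta>" "\<beta> < 1"
  defines "S \<equiv> subgraph f \<inter> ({..<\<beta>} \<times> {0<..})"
  shows "prob (win_event f S) = (LINT p|lborel. indicator S p * win_density f p)"
proof -
  \<comment> \<open>Adding 1 keeps the cells nondegenerate even if the curve vanishes.\<close>
  define K where "K = f \<beta> + 1"
  have K: "1 \<le> K" using curve_nonneg[OF f, of \<beta>] by (simp add: K_def)
  have S_m: "S \<in> sets borel"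
    unfolding S_def using f by (intro sets.Int subgraph_measurable rectangle_measurable) auto
  have S_le: "0 \<le> t \<and> t < \<beta> \<and> 0 < x \<and> x \<le> K" if "(t, x) \<in> S" for t x
    using that curve_mono[OF f, of t \<beta>] \<beta> by (auto simp: S_def subgraph_def K_def)
  let ?d = "prob (win_event f S) - (LINT p|lborel. indicator S p * win_density f p)"
  have bound: "\<bar>?d\<bar> \<le> 2 * K\<^sup>2 / real (Suc n)" for n
  proof -
    define m where "m = real (Suc n)"
    have m: "0 < m" by (simp add: m_def)
    \<comment> \<open>Cells are closed on the left in time, so that time 0 is covered, and open
      below in score, as the upper bound for a cell demands.\<close>
    define C where "C = (\<lambda>(i, j). S \<inter> ({\<beta> * real i / m..<\<beta> * real (Suc i) / m} \<times> {K * real j / m<..K * real (Suc j) / m}))"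
    define I where "I = {..n} \<times> {..n}"
    have C_m: "C q \<in> sets borel" for q
      unfolding C_def case_prod_unfold using S_m by (intro sets.Int rectangle_measurable) auto
    have C_strip: "C q \<subseteq> strip" for q
      using S_le \<beta> by (fastforce simp: C_def strip_def case_prod_unfold)
    have C_iff: "(t, x) \<in> C (i, j) \<longleftrightarrow> (t, x) \<in> S \<and> real i \<le> m * t / \<beta> \<and> m * t / \<beta> < real i + 1
        \<and> real j < m * x / K \<and> m * x / K \<le> real j + 1" for t x i j
      using m \<beta> K by (auto simp: C_def field_simps)
    have disj: "disjoint_family_on C I"
      unfolding disjoint_family_on_def
    proof (intro ballI impI)
      fix q q' :: "nat \<times> nat" assume "q \<noteq> q'"
      obtain i j i' j' where q: "q = (i, j)" "q' = (i', j')" by (metis surj_pair)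
      have False if "(t, x) \<in> C (i, j)" "(t, x) \<in> C (i', j')" for t x
      proof -
        have "real i < real i' + 1" "real i' < real i + 1" "real j < real j' + 1" "real j' < real j + 1"
          using that unfolding C_iff by auto
        then have "i = i'" "j = j'" by linarith+
        with \<open>q \<noteq> q'\<close> q show False by simp
      qed
      then show "C q \<inter> C q' = {}" unfolding q by (metis disjoint_iff surj_pair)
    qed
    have cover: "S = (\<Union>q\<in>I. C q)"
    proof
      show "(\<Union>q\<in>I. C q) \<subseteq> S" by (auto simp: C_def)
      show "S \<subseteq> (\<Union>q\<in>I. C q)"
      proof
        fix p assume "p \<in> S"
        then obtain t x where p: "p = (t, x)" "(t, x) \<in> S" by (cases p) auto
        note b = S_le[OF p(2)]
        define i where "i = nat \<lfloor>m * t / \<beta>\<rfloor>"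
        \<comment> \<open>Ceiling minus one, since a score on a grid line belongs to the cell below
          that line.\<close>
        define j where "j = nat (\<lceil>m * x / K\<rceil> - 1)"
        have y: "0 \<le> m * t / \<beta>" "m * t / \<beta> < m" "0 < m * x / K" "m * x / K \<le> m"
          using b m \<beta> K by (auto simp: field_simps)
        have i: "real i \<le> m * t / \<beta>" "m * t / \<beta> < real i + 1"
          using y unfolding i_def by (auto simp: of_nat_nat)
        have "0 < \<lceil>m * x / K\<rceil>" using y(3) by simp
        then have "real j = of_int \<lceil>m * x / K\<rceil> - 1" unfolding j_def by simp
        then have j: "real j < m * x / K" "m * x / K \<le> real j + 1"
          using ceiling_correct[of "m * x / K"] by auto
        have "(t, x) \<in> C (i, j)" unfolding C_iff using p i j by simp
        moreover have "(i, j) \<in> I"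
        proof -
          have "real i < real (Suc n)" "real j < real (Suc n)"
            using i j y by (auto simp: m_def)
          then show ?thesis by (simp add: I_def)
        qed
        ultimately show "p \<in> (\<Union>q\<in>I. C q)" using p by blast
      qed
    qed
    have C_int: "integrable lborel (\<lambda>p. indicator (C q) p * win_density f p)" for q
      by (rule integrable_real_mult_indicator[OF _ win_density_integrable[OF f],
          unfolded mult.commute[of "win_density f _"]]) (use C_m in auto)
    have "win_event f S = (\<Union>q\<in>I. win_event f (C q))"
      unfolding cover by (auto simp: win_event_def)
    then have "prob (win_event f S) = (\<Sum>q\<in>I. prob (win_event f (C q)))"
    proof (simp only:, intro finite_measure_finite_Union)
      show "disjoint_family_on (\<lambda>q. win_event f (C q)) I"
        using disj unfolding disjoint_family_on_def win_event_def by blast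
      show "(\<lambda>q. win_event f (C q)) ` I \<subseteq> events"
        using win_event_event[OF f C_m C_strip] by blast
    qed (simp add: I_def)
    moreover have "(LINT p|lborel. indicator S p * win_density f p)
      = (\<Sum>q\<in>I. LINT p|lborel. indicator (C q) p * win_density f p)"
    proof -
      have "indicator S p * win_density f p = (\<Sum>q\<in>I. indicator (C q) p * win_density f p)" for p
        unfolding cover sum_distrib_right[symmetric]
        by (subst indicator_UN_disjoint) (use disj in \<open>auto simp: I_def\<close>)
      then show ?thesis using C_int by simp
    qed
    ultimately have "\<bar>?d\<bar> \<le> (\<Sum>q\<in>I. \<bar>prob (win_event f (C q)) - (LINT p|lborel. indicator (C q) p * win_density f p)\<bar>)"
      by (simp only: sum_subtractf[symmetric] sum_abs)
    also have "\<dots> \<le> (\<Sum>q\<in>I. 2 * K\<^sup>2 / m ^ 3)"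
    proof (rule sum_mono)
      fix q assume "q \<in> I"
      then obtain i j where q: "q = (i, j)" "i \<le> n" by (auto simp: I_def)
      define a b c d where "a = \<beta> * real i / m" and "b = \<beta> * real (Suc i) / m"
        and "c = K * real j / m" and "d = K * real (Suc j) / m"
      have ba: "b - a = \<beta> / m" and dc: "d - c = K / m"
        by (simp_all add: a_def b_def c_def d_def diff_divide_distrib[symmetric] algebra_simps)
      have "\<beta> * real (Suc i) \<le> \<beta> * m" using q \<beta> by (simp add: m_def)
      then have b: "b \<le> \<beta>" using m by (simp add: b_def field_simps)
      have "\<bar>prob (win_event f (C q)) - (LINT p|lborel. indicator (C q) p * win_density f p)\<bar>
        \<le> ((b - a) * (d - c)) * (f b * (b - a) + (d - c))"
      proof (rule win_event_cell[OF f C_m])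
        show "C q \<subseteq> subgraph f" by (auto simp: C_def S_def case_prod_unfold)
        show "C q \<subseteq> {a..<b} \<times> {c<..d}" by (auto simp: q C_def a_def b_def c_def d_def)
        show "0 \<le> a" using m \<beta> by (simp add: a_def)
        show "a \<le> b" using ba divide_pos_pos[OF \<beta>(1) m] by linarith
        show "b < 1" using b \<beta> by simp
        show "0 \<le> c" using m K by (simp add: c_def)
        show "c \<le> d" using dc divide_nonneg_pos[OF _ m, of K] K by linarith
      qed
      also have "\<dots> \<le> (K / m / m) * (2 * K / m)"
      proof (rule mult_mono)
        have "\<beta> * K \<le> 1 * K" using \<beta> K by (intro mult_right_mono) auto
        then have "\<beta> * K / m / m \<le> K / m / m" using m by (intro divide_right_mono) auto
        then show "(b - a) * (d - c) \<le> K / m / m" by (simp add: ba dc)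
        have "f b * \<beta> \<le> K * 1"
          using curve_mono[OF f b \<beta>(2)] curve_nonneg[OF f] \<beta> K by (intro mult_mono) (auto simp: K_def)
        then have "(f b * \<beta> + K) / m \<le> 2 * K / m" using m by (intro divide_right_mono) auto
        then show "f b * (b - a) + (d - c) \<le> 2 * K / m" by (simp add: ba dc add_divide_distrib)
        show "0 \<le> f b * (b - a) + (d - c)"
          using curve_nonneg[OF f, of b] m \<beta> K by (simp add: ba dc)
        show "0 \<le> K / m / m" using m K by simp
      qed
      also have "\<dots> = 2 * K\<^sup>2 / m ^ 3" by (simp add: power2_eq_square power3_eq_cube)
      finally show "\<bar>prob (win_event f (C q)) - (LINT p|lborel. indicator (C q) p * win_density f p)\<bar>
        \<le> 2 * K\<^sup>2 / m ^ 3" .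
    qed
    also have "\<dots> = m\<^sup>2 * (2 * K\<^sup>2 / m ^ 3)"
    proof -
      have "real (card I) = m\<^sup>2"
        by (simp add: I_def m_def card_cartesian_product power2_eq_square algebra_simps)
      then show ?thesis by simp
    qed
    also have "\<dots> = 2 * K\<^sup>2 / m"
      using m by (simp add: power2_eq_square power3_eq_cube)
    finally show ?thesis by (simp add: m_def)
  qed
  have "(\<lambda>n. 2 * K\<^sup>2 / real (Suc n)) \<longlonglongrightarrow> 0"
    by (rule LIMSEQ_Suc[OF lim_const_over_n])
  then have "\<bar>?d\<bar> \<le> 0" by (rule LIMSEQ_le_const) (use bound in auto)
  then show ?thesis by simp
qed

text \<open>The truncations exhaust the subgraph above score 0. Continuity from below on the
  probability side meets dominated convergence on the integral side, and what remains on either side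
  is null.\<close>

lemma win_prob_eq:
  assumes f: "curve f"
  shows "win_prob M \<Phi> f = win_integral f"
proof -
  define \<beta> where "\<beta> k = 1 - 1 / real (k + 2)" for k
  have \<beta>: "0 < \<beta> k" "\<beta> k < 1" for k by (auto simp: \<beta>_def field_simps)
  have \<beta>_mono: "\<beta> k \<le> \<beta> l" if "k \<le> l" for k l
    using that by (simp add: \<beta>_def frac_le)
  define S where "S k = subgraph f \<inter> ({..<\<beta> k} \<times> {0<..})" for k
  have S_m: "S k \<in> sets borel" for k
    unfolding S_def using f by (intro sets.Int subgraph_measurable rectangle_measurable) auto
  have S_inc: "incseq S"
    unfolding incseq_def S_def using \<beta>_mono by (force intro: less_le_trans)
  have S_UN: "(\<Union>k. S k) = subgraph f \<inter> (UNIV \<times> {0<..})"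
  proof
    show "subgraph f \<inter> (UNIV \<times> {0<..}) \<subseteq> (\<Union>k. S k)"
    proof
      fix p assume p: "p \<in> subgraph f \<inter> (UNIV \<times> {0<..})"
      then have "0 < 1 - fst p" by (auto simp: subgraph_def)
      from reals_Archimedean[OF this] obtain k where "inverse (real (Suc k)) < 1 - fst p" by blast
      moreover have "1 / real (k + 2) \<le> inverse (real (Suc k))" by (simp add: field_simps)
      ultimately have "fst p < \<beta> k" by (simp add: \<beta>_def)
      then show "p \<in> (\<Union>k. S k)" using p by (auto simp: S_def)
    qed
  qed (auto simp: S_def)
  have S_strip: "S k \<subseteq> strip" for k by (auto simp: S_def subgraph_def strip_def)
  have "(\<lambda>k. prob (win_event f (S k))) \<longlonglongrightarrow> prob (\<Union>k. win_event f (S k))"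
  proof (rule finite_Lim_measure_incseq)
    show "range (\<lambda>k. win_event f (S k)) \<subseteq> events" using win_event_event[OF f S_m S_strip] by blast
    show "incseq (\<lambda>k. win_event f (S k))"
      using S_inc unfolding incseq_def win_event_def by blast
  qed
  moreover have "prob (\<Union>k. win_event f (S k)) = win_prob M \<Phi> f"
    unfolding win_prob_def
  proof (rule measure_eq_AE)
    show "(\<Union>k. win_event f (S k)) \<in> events" using win_event_event[OF f S_m S_strip] by blast
    show "{\<omega> \<in> space M. memoryless_time f (\<Phi> \<omega>) = best_time (\<Phi> \<omega>)} \<in> events"
      by (rule success_event[OF f])
    show "AE \<omega> in M. \<omega> \<in> (\<Union>k. win_event f (S k)) \<longleftrightarrow>
        \<omega> \<in> {\<omega> \<in> space M. memoryless_time f (\<Phi> \<omega>) = best_time (\<Phi> \<omega>)}"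
      using AE_atom AE_inj_time AE_inj_score AE_interior AE_space
    proof eventually_elim
      case (elim \<omega>)
      note lf = locally_finite_atoms[OF elim(5)]
      have best: "has_best (\<Phi> \<omega>)" by (rule has_best_if_inj[OF lf elim(1,3)])
      let ?p = "best_atom (\<Phi> \<omega>)"
      have p: "?p \<in> \<Phi> \<omega>" by (rule has_bestD(1)[OF best])
      have "?p \<in> subgraph f \<inter> (UNIV \<times> {0<..})" if \<tau>: "memoryless_time f (\<Phi> \<omega>) = best_time (\<Phi> \<omega>)"
      proof -
        have "\<Phi> \<omega> \<inter> subgraph f \<noteq> {}"
        proof
          assume "\<Phi> \<omega> \<inter> subgraph f = {}"
          then have "fst ?p = 1" using \<tau> by (simp add: memoryless_time_empty best_time_def)
          with elim(4) p show False by force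
        qed
        then obtain q where q: "q \<in> \<Phi> \<omega> \<inter> subgraph f" "memoryless_time f (\<Phi> \<omega>) = fst q"
          using memoryless_attained[OF f lf] by blast
        then have "fst q = fst ?p" using \<tau> by (simp add: best_time_def)
        \<comment> \<open>Equal times give equal atoms because almost surely no two atoms are
          simultaneous.\<close>
        then have "q = ?p" by (rule inj_onD[OF elim(2)]) (use q p in auto)
        moreover have "0 < snd ?p" using elim(4) p by blast
        ultimately show ?thesis using q by (simp add: mem_Times_iff)
      qed
      then show ?case
        using elim(5) best unfolding S_UN[symmetric] by (auto simp: win_event_def)
    qed
  qed
  moreover have "(\<lambda>k. prob (win_event f (S k))) \<longlonglongrightarrow> win_integral f"
  proof -
    have "(\<lambda>k. LINT p|lborel. indicator (S k) p * win_density f p)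
      \<longlonglongrightarrow> (LINT p|lborel. indicator (\<Union>k. S k) p * win_density f p)"
    proof (rule integral_dominated_convergence[OF _ _ win_density_integrable[OF f]])
      show "(\<lambda>p. indicator (\<Union>k. S k) p * win_density f p) \<in> borel_measurable lborel"
        using S_m win_density_measurable[OF f] by (intro borel_measurable_times borel_measurable_indicator) auto
      show "(\<lambda>p. indicator (S k) p * win_density f p) \<in> borel_measurable lborel" for k
        using S_m win_density_measurable[OF f] by (intro borel_measurable_times borel_measurable_indicator) auto
      show "AE p in lborel. (\<lambda>k. indicator (S k) p * win_density f p)
          \<longlonglongrightarrow> indicator (\<Union>k. S k) p * win_density f p"
        by (intro AE_I2 tendsto_mult_right LIMSEQ_indicator_incseq S_inc)
      show "AE p in lborel. norm (indicator (S k) p * win_density f p) \<le> win_density f p" for k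
        using win_density_nonneg by (intro AE_I2) (auto simp: indicator_def)
    qed
    moreover have "(LINT p|lborel. indicator (\<Union>k. S k) p * win_density f p) = win_integral f"
      unfolding win_integral_def
    proof (rule integral_cong_AE)
      show "(\<lambda>p. indicator (\<Union>k. S k) p * win_density f p) \<in> borel_measurable lborel"
        using S_m win_density_measurable[OF f] by (intro borel_measurable_times borel_measurable_indicator) auto
      show "win_density f \<in> borel_measurable lborel" using win_density_measurable[OF f] by simp
      \<comment> \<open>The density need not vanish at score 0, but that line is a null set of the
        plane.\<close>
      have "emeasure (lborel \<Otimes>\<^sub>M lborel) (UNIV \<times> {0::real} :: (real \<times> real) set)
        = emeasure lborel (UNIV :: real set) * emeasure lborel {0::real}"
        by (rule lborel.emeasure_pair_measure_Times) auto
      then have "UNIV \<times> {0::real} \<in> null_sets (lborel :: (real \<times> real) measure)"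
        by (intro null_setsI) (auto simp: lborel_prod)
      then show "AE p in lborel. indicator (\<Union>k. S k) p * win_density f p = win_density f p"
      proof (rule AE_I')
        show "{p \<in> space lborel. indicator (\<Union>k. S k) p * win_density f p \<noteq> win_density f p} \<subseteq> UNIV \<times> {0}"
          unfolding S_UN by (auto simp: win_density_def subgraph_def indicator_def)
      qed
    qed
    ultimately show ?thesis
      using win_event_truncated[OF f \<beta>] by (simp add: S_def)
  qed
  ultimately show ?thesis by (metis LIMSEQ_unique)
qed

end

section \<open>Optimal curves\<close>

lemma curve_restrict:
  assumes "f \<in> threshold_curves"
  shows "curve (\<lambda>t. if t \<in> {0..<1} then f t else 0)" (is "curve ?g")
proof (rule curveI)
  have f: "cadlag f" "mono_on {0..<1} f" "\<forall>t\<in>{0..<1}. 0 \<le> f t"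
    using assms by (auto simp: threshold_curves_def)
  show "?g s \<le> ?g t" if "0 \<le> s" "s \<le> t" "t < 1" for s t
    using f(2) that by (auto simp: mono_on_def)
  show "(?g \<longlongrightarrow> ?g t) (at_right t)" if t: "0 \<le> t" "t < 1" for t
  proof -
    have "(f \<longlongrightarrow> f t) (at_right t)" using f(1) t by (auto simp: cadlag_def continuous_within)
    moreover have "eventually (\<lambda>s. f s = ?g s) (at_right t)"
      unfolding eventually_at_right_field using t by (intro exI[of _ 1]) auto
    ultimately have "(?g \<longlongrightarrow> f t) (at_right t)" by (rule Lim_transform_eventually)
    then show ?thesis using t by simp
  qed
  show "\<exists>l. (?g \<longlongrightarrow> l) (at_left t)" if t: "0 < t" "t < 1" for t
  proof -
    have "t \<in> {0<..<1}" using t by simp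
    then obtain l where l: "(f \<longlongrightarrow> l) (at_left t)" using f(1) unfolding cadlag_def by blast
    moreover have "eventually (\<lambda>s. f s = ?g s) (at_left t)"
      unfolding eventually_at_left_field using t by (intro exI[of _ 0]) auto
    ultimately have "(?g \<longlongrightarrow> l) (at_left t)" by (rule Lim_transform_eventually)
    then show ?thesis by blast
  qed
qed (use assms in \<open>auto simp: threshold_curves_def\<close>)

lemma memoryless_time_cong:
  assumes "\<And>t. t \<in> {0..<1} \<Longrightarrow> f t = g t"
  shows "memoryless_time f = memoryless_time g"
proof -
  have "subgraph f = subgraph g" using assms by (auto simp: subgraph_def)
  then show ?thesis by (simp only: memoryless_time_def[abs_def] memoryless_point_def)
qed

lemma partial_win_cong:
  assumes eq: "\<And>t. t \<in> {0..<1} \<Longrightarrow> f t = g t" and t: "t \<in> {0..<1}"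
  shows "partial_win f t = partial_win g t"
proof -
  have "{t\<in>{0..<1}. f t < x} = {t\<in>{0..<1}. g t < x}" for x using eq by auto
  then have "gen_inverse f = gen_inverse g" by (simp only: gen_inverse_def[abs_def])
  then have "inverse_integral f = inverse_integral g" by (simp only: inverse_integral_def[abs_def])
  moreover have "curve_integral f u = curve_integral g u" if "u \<in> {t..<1}" for u
    unfolding curve_integral_def
    by (rule set_lebesgue_integral_cong) (use eq that in auto)
  ultimately show ?thesis
    unfolding partial_win_def using eq[OF t]
    by (intro set_lebesgue_integral_cong) auto
qed

theorem theorem3:
  fixes M :: "'w measure" and \<Phi> :: "'w \<Rightarrow> (real \<times> real) set" and f :: "real \<Rightarrow> real"
  assumes "unit_poisson_process M \<Phi>"
    and "optimal_curve M \<Phi> f"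
  shows "(\<forall>t\<in>{0..<1}. exp (- f t) = partial_win f t) \<and>
    prob_space.expectation M (\<lambda>\<omega>. memoryless_time f (\<Phi> \<omega>)) = optimal_value M \<Phi>"
proof -
  note win_prob_eq = unit_poisson_process.win_prob_eq[OF assms(1)]
  note expectation_eq = unit_poisson_process.expectation_memoryless_time[OF assms(1)]
  have prob_space: "prob_space M" using assms(1) by (simp add: unit_poisson_process_def)
  have f: "f \<in> threshold_curves" and v: "win_prob M \<Phi> f = optimal_value M \<Phi>"
    using assms(2) by (auto simp: optimal_curve_def)
  \<comment> \<open>The stopping time and the equation read the curve on \<open>[0,1)\<close> only,
    so this normalised version can stand in for \<open>f\<close>.\<close>
  define g where "g t = (if t \<in> {0..<1} then f t else 0)" for t
  have eq: "f t = g t" if "t \<in> {0..<1}" for t using that by (simp add: g_def)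
  have g: "curve g" unfolding g_def by (rule curve_restrict[OF f])
  have \<tau>: "memoryless_time f = memoryless_time g" by (rule memoryless_time_cong[OF eq])
  then have vg: "optimal_value M \<Phi> = win_integral g"
    using v win_prob_eq[OF g] by (simp add: win_prob_def)
  have opt: "win_integral f' \<le> win_integral g" if f': "curve f'" for f'
  proof -
    \<comment> \<open>The supremum of reals is an upper bound only for a bounded family;
      probabilities are at most 1.\<close>
    have "bdd_above (win_prob M \<Phi> ` threshold_curves)"
      by (rule bdd_aboveI2[where M=1]) (simp add: win_prob_def prob_space.prob_le_1[OF prob_space])
    then have "win_prob M \<Phi> f' \<le> optimal_value M \<Phi>"
      unfolding optimal_value_def using f' by (intro cSUP_upper) (auto simp: curve_def)
    then show ?thesis by (simp add: win_prob_eq[OF f'] vg)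
  qed
  show ?thesis
  proof (intro conjI ballI)
    fix t :: real assume t: "t \<in> {0..<1}"
    have "exp (- g t) = win_mass g t (g t)"
      using gain_optimal[OF g opt t] by (simp add: gain_def)
    also have "\<dots> = partial_win g t" using partial_win_eq_win_mass[OF g] t by simp
    finally show "exp (- f t) = partial_win f t"
      using partial_win_cong[OF eq t] eq[OF t] by simp
  next
    show "prob_space.expectation M (\<lambda>\<omega>. memoryless_time f (\<Phi> \<omega>)) = optimal_value M \<Phi>"
      unfolding \<tau> vg expectation_eq[OF g] by (rule mean_time_optimal[OF g opt])
  qed
qed

end
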